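(* Let $k\geq 4$ and let $G$ be a connected graph of order $n$ with chromatic number $\chi(G)=k$ and independence number $\alpha(G)\leq 2$. Then for every natural number $x\geq k$, $$\pi(G,x)\leq (x)_{\downarrow k}\,(x-1)^{n-k}.$$ Furthermore, equality holds if and only if $G\cong F_{1,k}$, $G\cong F_{2,k}$, or $k=n$.
   Context: All graphs are finite and simple. For a nonnegative integer $x$, an $x$-coloring of $G$ is a map $f:V(G)\to\{1,\dots,x\}$ with $f(u)\neq f(v)$ for every edge $uv$; $\pi(G,x)$ denotes the chromatic polynomial of $G$, which for nonnegative integers $x$ counts the $x$-colorings of $G$. $(x)_{\downarrow k}=x(x-1)\cdots(x-k+1)$ is the falling factorial. $\alpha(G)$ is the maximum size of a set of pairwise nonadjacent vertices. $F_{1,k}$ denotes the graph obtained from the complete graph $K_k$ by attaching a path with one edge to a vertex of the clique (i.e. a new vertex of degree $1$ adjacent to one clique vertex); $F_{2,k}$ denotes the graph obtained from $K_k$ by attaching a path with two edges to a vertex of the clique (new vertices $a,b$ with edges $va$ and $ab$ for some clique vertex $v$). *)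

theory Defs
  imports
    "Graph_Theory.Graph_Theory"
    "HOL-Computational_Algebra.Polynomial"
    "HOL-Library.FuncSet"
begin

text \<open>
  A finite simple graph is a \<^locale>\<open>pair_graph\<close> of the AFP entry Graph_Theory: a finite vertex set
  with a symmetric irreflexive set of arcs, each edge \<open>uv\<close> being represented by the two arcs
  \<open>(u, v)\<close> and \<open>(v, u)\<close>.
\<close>

definition colorings :: "'a pair_pre_digraph \<Rightarrow> nat \<Rightarrow> ('a \<Rightarrow> nat) set" where
  "colorings G x = {f \<in> pverts G \<rightarrow>\<^sub>E {1..x}. \<forall>(u, v) \<in> parcs G. f u \<noteq> f v}"

definition chromatic_number :: "'a pair_pre_digraph \<Rightarrow> nat" where
  "chromatic_number G = (LEAST x. colorings G x \<noteq> {})"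

definition independent_set :: "'a pair_pre_digraph \<Rightarrow> 'a set \<Rightarrow> bool" where
  "independent_set G S \<longleftrightarrow> S \<subseteq> pverts G \<and> (\<forall>u\<in>S. \<forall>v\<in>S. (u, v) \<notin> parcs G)"

definition independence_number :: "'a pair_pre_digraph \<Rightarrow> nat" where
  "independence_number G = Max (card ` {S. independent_set G S})"

text \<open>
  The chromatic polynomial is the unique integer polynomial that counts the colorings;
  existence and uniqueness are proved below.
\<close>

definition chromatic_polynomial :: "'a pair_pre_digraph \<Rightarrow> int poly" where
  "chromatic_polynomial G =
     (THE p. \<forall>x::nat. poly p (int x) = int (card (colorings G x)))"

definition falling_factorial :: "'a::comm_ring_1 \<Rightarrow> nat \<Rightarrow> 'a" where
  "falling_factorial x k = (\<Prod>i<k. x - of_nat i)"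

text \<open>
  The complete graph on the vertices \<open>0, \<dots>, k - 1\<close> (for \<open>k \<ge> 1\<close>) with a path with \<open>l\<close> edges attached
  to the vertex \<open>k - 1\<close>. The path is \<open>k - 1, k, \<dots>, k + l - 1\<close>; the pairs of consecutive numbers
  below \<open>k\<close> are edges of the clique anyway.
\<close>

definition clique_with_path :: "nat \<Rightarrow> nat \<Rightarrow> nat pair_pre_digraph" where
  "clique_with_path l k =
     \<lparr> pverts = {..<k + l},
       parcs = {(i, j). i < k + l \<and> j < k + l \<and> i \<noteq> j \<and>
                        (i < k \<and> j < k \<or> j = Suc i \<or> i = Suc j)} \<rparr>"

lemma pair_graph_clique_with_path: "pair_graph (clique_with_path l k)"
proof -
  have "parcs (clique_with_path l k) \<subseteq> {..<k + l} \<times> {..<k + l}"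
    by (auto simp: clique_with_path_def)
  then have "finite (parcs (clique_with_path l k))"
    by (rule finite_subset) simp
  then show ?thesis
    by unfold_locales (auto simp: clique_with_path_def symmetric_def sym_def)
qed

lemma ex_counting_poly:
  assumes "finite E" "finite W" "E \<subseteq> W \<times> W"
  shows "\<exists>p::int poly. \<forall>x::nat.
    poly p (int x) = int (card {f \<in> W \<rightarrow>\<^sub>E {1..x}. \<forall>(u, v) \<in> E. f u \<noteq> f v})"
  using assms
proof (induction "card E" arbitrary: E W rule: less_induct)
  case less
  let ?C = "\<lambda>E W (x::nat). {f \<in> W \<rightarrow>\<^sub>E {1..x}. \<forall>(u, v) \<in> E. f u \<noteq> f v}"
  have fin: "finite (?C E' W' x)" if "finite W'" for E' and W' :: "'a set" and x
    using that by (auto intro!: finite_PiE)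
  show ?case
  proof (cases "E = {}")
    case True
    have "poly (monom 1 (card W)) (int x) = int (card (?C E W x))" for x
      using True less.prems by (simp add: poly_monom card_PiE)
    then show ?thesis by blast
  next
    case False
    then obtain u v where uv: "(u, v) \<in> E" by auto
    define E' where "E' = E - {(u, v)}"
    have E: "E = insert (u, v) E'" using uv by (auto simp: E'_def)
    have cE': "card E' < card E" unfolding E'_def by (rule card_Diff1_less) (use uv less.prems in auto)
    have inW: "u \<in> W" "v \<in> W" using uv less.prems by auto
    show ?thesis
    proof (cases "u = v")
      case True
      then have "?C E W x = {}" for x using uv by auto
      then have "poly 0 (int x) = int (card (?C E W x))" for x by (simp only: card.empty) simp
      then show ?thesis by blast
    next
      case False
      define g where "g = (\<lambda>w. if w = v then u else w)"
      define F where "F = map_prod g g ` E'"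
      have finE': "finite E'" using less.prems by (simp add: E'_def)
      have "card F \<le> card E'" unfolding F_def by (rule card_image_le[OF finE'])
      then have cF: "card F < card E" using cE' by simp
      have "E' \<subseteq> W \<times> W" using less.prems by (auto simp: E'_def)
      then have FW: "F \<subseteq> (W - {v}) \<times> (W - {v})"
        using inW False by (auto simp: F_def g_def split: if_splits)
      obtain p where p: "\<And>x. poly p (int x) = int (card (?C E' W x))"
        using less.hyps[OF cE' finE' less.prems(2) \<open>E' \<subseteq> W \<times> W\<close>] by blast
      obtain q where q: "\<And>x. poly q (int x) = int (card (?C F (W - {v}) x))"
        using less.hyps[OF cF _ _ FW] finE' less.prems(2) by (auto simp: F_def)
      have "poly (p - q) (int x) = int (card (?C E W x))" for x
      proof -
        let ?B = "{f \<in> ?C E' W x. f u = f v}"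
        have "bij_betw (\<lambda>f. restrict f (W - {v})) ?B (?C F (W - {v}) x)"
        proof (rule bij_betw_byWitness[where f' = "\<lambda>h. h(v := h u)"])
          show "\<forall>f\<in>?B. (restrict f (W - {v}))(v := restrict f (W - {v}) u) = f"
            using inW False by (auto simp: fun_eq_iff PiE_def extensional_def)
          show "\<forall>h\<in>?C F (W - {v}) x. restrict (h(v := h u)) (W - {v}) = h"
            by (auto simp: fun_eq_iff PiE_def extensional_def)
          show "(\<lambda>f. restrict f (W - {v})) ` ?B \<subseteq> ?C F (W - {v}) x"
          proof (intro image_subsetI CollectI conjI)
            fix f assume f: "f \<in> ?B"
            show "restrict f (W - {v}) \<in> (W - {v}) \<rightarrow>\<^sub>E {1..x}"
              using f by (auto simp: PiE_iff)
            have fg: "restrict f (W - {v}) (g w) = f w" if "w \<in> W" for w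
              using f that inW False by (simp add: g_def)
            have "f a \<noteq> f b" if "(a, b) \<in> E'" for a b
              using f that by blast
            then have "restrict f (W - {v}) (g a) \<noteq> restrict f (W - {v}) (g b)"
              if "(a, b) \<in> E'" for a b
              using fg that \<open>E' \<subseteq> W \<times> W\<close> by (metis (no_types, lifting) SigmaD1 SigmaD2 subsetD)
            then show "\<forall>(a, b)\<in>F. restrict f (W - {v}) a \<noteq> restrict f (W - {v}) b"
              unfolding F_def by (auto simp del: restrict_apply)
          qed
          show "(\<lambda>h. h(v := h u)) ` ?C F (W - {v}) x \<subseteq> ?B"
          proof (intro image_subsetI CollectI conjI)
            fix h assume h: "h \<in> ?C F (W - {v}) x"
            show "h(v := h u) \<in> W \<rightarrow>\<^sub>E {1..x}"
              using h inW False by (auto simp: PiE_iff extensional_def)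
            show "(h(v := h u)) u = (h(v := h u)) v" using False by simp
            have hg: "(h(v := h u)) w = h (g w)" for w by (simp add: g_def)
            have "h (g a) \<noteq> h (g b)" if "(a, b) \<in> E'" for a b
            proof -
              have "(g a, g b) \<in> F" unfolding F_def using that by force
              then show ?thesis using h by blast
            qed
            then show "\<forall>(a, b)\<in>E'. (h(v := h u)) a \<noteq> (h(v := h u)) b"
              unfolding hg by blast
          qed
        qed
        then have B: "card ?B = card (?C F (W - {v}) x)" by (rule bij_betw_same_card)
        have C: "?C E W x = ?C E' W x - ?B" by (auto simp: E)
        have BC: "?B \<subseteq> ?C E' W x" by blast
        have "card (?C E' W x - ?B) = card (?C E' W x) - card ?B"
          using finite_subset[OF BC fin[OF less.prems(2)]] BC by (rule card_Diff_subset)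
        moreover have "card ?B \<le> card (?C E' W x)"
          using fin[OF less.prems(2)] BC by (rule card_mono)
        ultimately show ?thesis unfolding poly_diff p q C B[symmetric] by linarith
      qed
      then show ?thesis by blast
    qed
  qed
qed

lemma int_poly_eqI:
  fixes p q :: "int poly"
  assumes "\<And>x::nat. poly p (int x) = poly q (int x)"
  shows "p = q"
proof (rule ccontr)
  assume "p \<noteq> q"
  then have "finite {y. poly (p - q) y = 0}" by (intro poly_roots_finite) simp
  moreover have "range int \<subseteq> {y. poly (p - q) y = 0}" using assms by auto
  ultimately have "finite (range int)" by (rule rev_finite_subset)
  then show False by (simp add: finite_image_iff)
qed

lemma poly_chromatic_polynomial:
  assumes "pair_graph G"
  shows "poly (chromatic_polynomial G) (int x) = int (card (colorings G x))"
proof -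
  interpret pair_graph G by fact
  have "\<exists>!p::int poly. \<forall>x::nat. poly p (int x) = int (card (colorings G x))"
  proof (rule ex_ex1I)
    show "\<exists>p::int poly. \<forall>x::nat. poly p (int x) = int (card (colorings G x))"
      unfolding colorings_def
      by (rule ex_counting_poly) (use pair_finite_verts pair_finite_arcs wellformed' in auto)
  qed (auto intro: int_poly_eqI)
  from theI'[OF this] show ?thesis unfolding chromatic_polynomial_def by blast
qed

end

theory Submission
  imports Defs
begin

text \<open>
  Write \<open>\<nu> = n - k\<close>. Deleting a vertex whose removal keeps the chromatic number costs at most a
  factor \<open>x - 1\<close>, so the point is the vertex-critical case. There the color class of a fixed vertex
  \<open>v\<close> is \<open>{v}\<close> or \<open>{v, w}\<close> with \<open>w\<close> nonadjacent to \<open>v\<close>, whence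
  \<open>\<pi>(G, x) \<le> x (\<pi>(G - v, x - 1) + \<Sum>w. \<pi>(G - v - w, x - 1))\<close>. Extending a \<open>(k - 1)\<close>-coloring of
  \<open>G - v\<close> shows that \<open>v\<close> has at most \<open>\<nu>\<close> nonneighbours. Induction first gives the bound with
  \<open>x (x - 1)^(\<nu> - 1)\<close> in place of \<open>(x - 1)^\<nu>\<close>, with no connectivity assumption; using it for the
  graphs \<open>G - v - w\<close>, a second induction gives the strict inequality for all \<open>G\<close> with \<open>k \<ge> 4\<close> that
  contain no \<open>k\<close>-clique.

  If \<open>G\<close> contains a \<open>k\<close>-clique, then coloring the other vertices one after the other, each adjacent
  to an earlier one, gives the bound. Equality forces every new vertex to see exactly one color;
  as \<open>\<alpha>(G) \<le> 2\<close> and \<open>k \<ge> 4\<close>, the vertices outside the clique are pairwise adjacent, so there are at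
  most two of them.
\<close>

section \<open>Colorings and the chromatic number\<close>

text \<open>The relation \<open>E\<close> lives on the whole type and the vertex set is a separate
  argument, so deleting vertices changes only the set.\<close>

definition proper :: "('a \<Rightarrow> 'a \<Rightarrow> bool) \<Rightarrow> 'a set \<Rightarrow> ('a \<Rightarrow> nat) \<Rightarrow> bool" where
  "proper E V f \<longleftrightarrow> (\<forall>u\<in>V. \<forall>v\<in>V. E u v \<longrightarrow> f u \<noteq> f v)"

text \<open>The palette \<open>K\<close> is arbitrary because removing the color class of color
  \<open>c\<close> leaves the palette \<open>{1..x} - {c}\<close>.\<close>

definition cols :: "('a \<Rightarrow> 'a \<Rightarrow> bool) \<Rightarrow> 'a set \<Rightarrow> nat set \<Rightarrow> ('a \<Rightarrow> nat) set" where
  "cols E V K = {f \<in> V \<rightarrow>\<^sub>E K. proper E V f}"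

abbreviation num_cols :: "('a \<Rightarrow> 'a \<Rightarrow> bool) \<Rightarrow> 'a set \<Rightarrow> nat \<Rightarrow> nat" where
  "num_cols E V x \<equiv> card (cols E V {1..x})"

text \<open>Counting the colors in use, instead of fixing a palette, lets recoloring arguments take
  any fresh natural number.\<close>

definition colorable :: "('a \<Rightarrow> 'a \<Rightarrow> bool) \<Rightarrow> 'a set \<Rightarrow> nat \<Rightarrow> bool" where
  "colorable E V n \<longleftrightarrow> (\<exists>f. proper E V f \<and> card (f ` V) \<le> n)"

definition chi :: "('a \<Rightarrow> 'a \<Rightarrow> bool) \<Rightarrow> 'a set \<Rightarrow> nat" where
  "chi E V = (LEAST n. colorable E V n)"

definition clique :: "('a \<Rightarrow> 'a \<Rightarrow> bool) \<Rightarrow> 'a set \<Rightarrow> bool" where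
  "clique E Q \<longleftrightarrow> (\<forall>u\<in>Q. \<forall>v\<in>Q. u \<noteq> v \<longrightarrow> E u v)"

definition alpha2 :: "('a \<Rightarrow> 'a \<Rightarrow> bool) \<Rightarrow> 'a set \<Rightarrow> bool" where
  "alpha2 E V \<longleftrightarrow> (\<forall>u\<in>V. \<forall>v\<in>V. \<forall>w\<in>V. u \<noteq> v \<longrightarrow> u \<noteq> w \<longrightarrow> v \<noteq> w \<longrightarrow> E u v \<or> E u w \<or> E v w)"

text \<open>Connectivity in cut form: it directly supplies the next vertex when a coloring grows
  outward from a set.\<close>

definition conn :: "('a \<Rightarrow> 'a \<Rightarrow> bool) \<Rightarrow> 'a set \<Rightarrow> bool" where
  "conn E V \<longleftrightarrow> (\<forall>S. S \<noteq> {} \<longrightarrow> S \<subset> V \<longrightarrow> (\<exists>u\<in>S. \<exists>v\<in>V - S. E u v))"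

definition nonnbrs :: "('a \<Rightarrow> 'a \<Rightarrow> bool) \<Rightarrow> 'a set \<Rightarrow> 'a \<Rightarrow> 'a set" where
  "nonnbrs E V v = {w \<in> V. w \<noteq> v \<and> \<not> E v w}"

lemma falling_factorial_Suc:
  "falling_factorial x (Suc k) = x * falling_factorial (x - 1) k"
  unfolding falling_factorial_def prod.lessThan_Suc_shift by (simp add: algebra_simps)

lemma falling_factorial_Suc':
  "falling_factorial x (Suc k) = falling_factorial x k * (x - of_nat k)"
  unfolding falling_factorial_def by simp

lemma falling_factorial_pos: "x \<ge> k \<Longrightarrow> falling_factorial (int x) k > 0"
  unfolding falling_factorial_def by (rule prod_pos) auto

lemma finite_cols: "finite V \<Longrightarrow> finite K \<Longrightarrow> finite (cols E V K)"
  by (simp add: cols_def finite_PiE)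

lemma proper_subset: "proper E V f \<Longrightarrow> W \<subseteq> V \<Longrightarrow> proper E W f"
  by (auto simp: proper_def)

lemma alpha2_subset: "alpha2 E V \<Longrightarrow> W \<subseteq> V \<Longrightarrow> alpha2 E W"
  unfolding alpha2_def by blast

lemma clique_subset: "clique E Q \<Longrightarrow> R \<subseteq> Q \<Longrightarrow> clique E R"
  unfolding clique_def by blast

text \<open>Conjugation by \<open>h\<close> and \<open>b\<close> is invertible. With
  \<open>h\<close> the identity it renames palettes; with \<open>b\<close> the identity it carries
  counts along graph isomorphisms.\<close>

lemma card_cols_bij:
  assumes h: "bij_betw h V W" and E: "\<And>u v. u \<in> V \<Longrightarrow> v \<in> V \<Longrightarrow> E u v \<longleftrightarrow> F (h u) (h v)"
    and b: "bij_betw b K L"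
  shows "card (cols E V K) = card (cols F W L)"
proof -
  define g where "g = inv_into V h"
  define c where "c = inv_into K b"
  have g: "bij_betw g W V" unfolding g_def by (rule bij_betw_inv_into[OF h])
  have c: "bij_betw c L K" unfolding c_def by (rule bij_betw_inv_into[OF b])
  have gh: "g (h v) = v" "h v \<in> W" if "v \<in> V" for v
    using bij_betw_inv_into_left[OF h that] bij_betwE[OF h] that by (simp_all add: g_def)
  have hg: "h (g v) = v" "g v \<in> V" if "v \<in> W" for v
    using bij_betw_inv_into_right[OF h that] bij_betwE[OF g] that by (simp_all add: g_def)
  have cb: "c (b i) = i" "b i \<in> L" if "i \<in> K" for i
    using bij_betw_inv_into_left[OF b that] bij_betwE[OF b] that by (simp_all add: c_def)
  have bc: "b (c i) = i" "c i \<in> K" if "i \<in> L" for i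
    using bij_betw_inv_into_right[OF b that] bij_betwE[OF c] that by (simp_all add: c_def)
  have "bij_betw (\<lambda>f. restrict (b \<circ> f \<circ> g) W) (cols E V K) (cols F W L)"
  proof (rule bij_betw_byWitness[where f' = "\<lambda>f. restrict (c \<circ> f \<circ> h) V"])
    show "\<forall>f\<in>cols E V K. restrict (c \<circ> restrict (b \<circ> f \<circ> g) W \<circ> h) V = f"
    proof (intro ballI ext)
      fix f v assume "f \<in> cols E V K"
      then have f: "f \<in> V \<rightarrow>\<^sub>E K" by (simp add: cols_def)
      show "restrict (c \<circ> restrict (b \<circ> f \<circ> g) W \<circ> h) V v = f v"
        using gh cb PiE_mem[OF f] PiE_arb[OF f] by (cases "v \<in> V") simp_all
    qed
    show "\<forall>f\<in>cols F W L. restrict (b \<circ> restrict (c \<circ> f \<circ> h) V \<circ> g) W = f"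
    proof (intro ballI ext)
      fix f v assume "f \<in> cols F W L"
      then have f: "f \<in> W \<rightarrow>\<^sub>E L" by (simp add: cols_def)
      show "restrict (b \<circ> restrict (c \<circ> f \<circ> h) V \<circ> g) W v = f v"
        using hg bc PiE_mem[OF f] PiE_arb[OF f] by (cases "v \<in> W") simp_all
    qed
    show "(\<lambda>f. restrict (b \<circ> f \<circ> g) W) ` cols E V K \<subseteq> cols F W L"
    proof (rule image_subsetI)
      fix f assume f: "f \<in> cols E V K"
      have "b (f (g u)) \<noteq> b (f (g v))" if "u \<in> W" "v \<in> W" "F u v" for u v
      proof -
        have "E (g u) (g v)" using that E hg by simp
        then have "f (g u) \<noteq> f (g v)" using f hg that by (simp add: cols_def proper_def)
        moreover have "f (g u) \<in> K" "f (g v) \<in> K"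
          using f hg(2) that PiE_mem[of f V "\<lambda>_. K"] by (simp_all add: cols_def)
        ultimately show ?thesis using cb by metis
      qed
      moreover have "b (f (g u)) \<in> L" if "u \<in> W" for u
        using f hg(2)[OF that] cb(2) PiE_mem[of f V "\<lambda>_. K" "g u"] by (simp add: cols_def)
      ultimately show "restrict (b \<circ> f \<circ> g) W \<in> cols F W L"
        by (simp add: cols_def proper_def)
    qed
    show "(\<lambda>f. restrict (c \<circ> f \<circ> h) V) ` cols F W L \<subseteq> cols E V K"
    proof (rule image_subsetI)
      fix f assume f: "f \<in> cols F W L"
      have "c (f (h u)) \<noteq> c (f (h v))" if "u \<in> V" "v \<in> V" "E u v" for u v
      proof -
        have "F (h u) (h v)" using that E by simp
        then have "f (h u) \<noteq> f (h v)" using f gh that by (simp add: cols_def proper_def)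
        moreover have "f (h u) \<in> L" "f (h v) \<in> L"
          using f gh(2) that PiE_mem[of f W "\<lambda>_. L"] by (simp_all add: cols_def)
        ultimately show ?thesis using bc by metis
      qed
      moreover have "c (f (h u)) \<in> K" if "u \<in> V" for u
        using f gh(2)[OF that] bc(2) PiE_mem[of f W "\<lambda>_. L" "h u"] by (simp add: cols_def)
      ultimately show "restrict (c \<circ> f \<circ> h) V \<in> cols E V K"
        by (simp add: cols_def proper_def)
    qed
  qed
  then show ?thesis by (rule bij_betw_same_card)
qed

lemma card_cols: "finite K \<Longrightarrow> card (cols E V K) = num_cols E V (card K)"
  using card_cols_bij[OF bij_betw_id, of V E E] finite_same_card_bij[of K "{1..card K}"] by auto

lemma colorable_mono: "colorable E V m \<Longrightarrow> m \<le> n \<Longrightarrow> colorable E V n"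
  unfolding colorable_def by (meson order_trans)

lemma colorable_card: 
  assumes "finite V" "\<And>v. \<not> E v v"
  shows "colorable E V (card V)"
proof -
  obtain f :: "'a \<Rightarrow> nat" where "inj_on f V" using finite_imp_inj_to_nat_seg[OF assms(1)] by auto
  then show ?thesis unfolding colorable_def proper_def
    using assms(2) by (intro exI[of _ f]) (auto simp: card_image dest: inj_onD)
qed

lemma colorable_iff_cols:
  assumes "finite V" 
  shows "colorable E V n \<longleftrightarrow> cols E V {1..n} \<noteq> {}"
proof
  assume "colorable E V n"
  then obtain f where f: "proper E V f" "card (f ` V) \<le> n" by (auto simp: colorable_def)
  then obtain h where h: "inj_on h (f ` V)" "h ` (f ` V) \<subseteq> {1..n}"
    using card_le_inj[of "f ` V" "{1..n}"] assms by (metis card_atLeastAtMost diff_Suc_1 finite_atLeastAtMost finite_imageI)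
  have "restrict (h \<circ> f) V \<in> cols E V {1..n}"
    using f h by (auto simp: cols_def proper_def inj_on_def)
  then show "cols E V {1..n} \<noteq> {}" by blast
next
  assume "cols E V {1..n} \<noteq> {}"
  then obtain f where f: "f \<in> V \<rightarrow>\<^sub>E {1..n}" "proper E V f" by (auto simp: cols_def)
  then have "f ` V \<subseteq> {1..n}" by auto
  then have "card (f ` V) \<le> n" using card_mono[of "{1..n}" "f ` V"] by simp
  then show "colorable E V n" using f by (auto simp: colorable_def)
qed

locale adjacency =
  fixes E :: "'a \<Rightarrow> 'a \<Rightarrow> bool"
  assumes sym: "E u v \<Longrightarrow> E v u" and irrefl: "\<not> E u u"
begin

lemma colorable_iff_chi:
  assumes "finite V"
  shows "colorable E V n \<longleftrightarrow> chi E V \<le> n"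
proof
  show "colorable E V n \<Longrightarrow> chi E V \<le> n" unfolding chi_def by (rule Least_le)
  have "colorable E V (chi E V)" unfolding chi_def
    by (rule LeastI) (rule colorable_card[of V E, OF assms irrefl])
  then show "chi E V \<le> n \<Longrightarrow> colorable E V n" by (rule colorable_mono)
qed

lemma chi_leI: "finite V \<Longrightarrow> proper E V f \<Longrightarrow> card (f ` V) \<le> n \<Longrightarrow> chi E V \<le> n"
  unfolding colorable_iff_chi[symmetric] colorable_def by blast

lemma chi_obtain:
  assumes "finite V"
  obtains f where "proper E V f" "card (f ` V) \<le> chi E V"
  using colorable_iff_chi[OF assms, of "chi E V"] unfolding colorable_def by blast

lemma chi_le_card: "finite V \<Longrightarrow> chi E V \<le> card V"
  using colorable_iff_chi colorable_card irrefl by metis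

lemma chi_mono: 
  assumes "finite V" "W \<subseteq> V" 
  shows "chi E W \<le> chi E V"
proof -
  obtain f where f: "proper E V f" "card (f ` V) \<le> chi E V" using chi_obtain[OF assms(1)] .
  have "card (f ` W) \<le> card (f ` V)" by (intro card_mono finite_imageI image_mono assms)
  then show ?thesis using f assms 
    by (intro chi_leI[of W f]) (auto intro: proper_subset finite_subset)
qed

lemma clique_le_chi:
  assumes "finite V" "Q \<subseteq> V" "clique E Q"
  shows "card Q \<le> chi E V"
proof -
  obtain f where f: "proper E V f" "card (f ` V) \<le> chi E V" using chi_obtain[OF assms(1)] .
  have "inj_on f Q" using assms f unfolding inj_on_def clique_def proper_def by blast
  then have "card Q = card (f ` Q)" by (simp add: card_image)
  also have "\<dots> \<le> card (f ` V)" by (intro card_mono finite_imageI image_mono assms)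
  finally show ?thesis using f by simp
qed

text \<open>One fresh color serves both \<open>v\<close> and \<open>w\<close>. The case
  \<open>v = w\<close> is included and covers the deletion of a single vertex.\<close>

lemma chi_le_Suc_pair:
  assumes "finite V" "\<not> E v w" 
  shows "chi E V \<le> Suc (chi E (V - {v, w}))"
proof -
  let ?W = "V - {v, w}"
  have fW: "finite ?W" using assms by simp
  obtain f where f: "proper E ?W f" "card (f ` ?W) \<le> chi E ?W" using chi_obtain[OF fW] .
  obtain c where c: "c \<notin> f ` ?W" using fW by (meson ex_new_if_finite finite_imageI infinite_UNIV_nat)
  define g where "g u = (if u \<in> {v, w} then c else f u)" for u
  have "proper E V g" unfolding proper_def g_def
    using f(1) c assms(2) irrefl sym[of w v] by (auto simp: proper_def)
  moreover have "g ` V \<subseteq> insert c (f ` ?W)" by (auto simp: g_def)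
  then have "card (g ` V) \<le> card (insert c (f ` ?W))" using fW by (intro card_mono) auto
  then have "card (g ` V) \<le> Suc (chi E ?W)" using f(2) fW card_insert_le_m1 by (simp add: card_insert_if split: if_splits)
  ultimately show ?thesis using assms chi_leI by blast
qed

lemma chi_le_Suc: "finite V \<Longrightarrow> chi E V \<le> Suc (chi E (V - {v}))"
  using chi_le_Suc_pair[of V v v] irrefl by simp

lemma chi_eq_card_iff:
  assumes "finite V"
  shows "chi E V = card V \<longleftrightarrow> clique E V"
proof
  assume eq: "chi E V = card V"
  show "clique E V" unfolding clique_def
  proof (intro ballI impI, rule ccontr)
    fix u v assume uv: "u \<in> V" "v \<in> V" "u \<noteq> v" "\<not> E u v"
    \<comment> \<open>A nonadjacent pair can share a color, which saves one color over giving every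
      vertex its own.\<close>
    have "chi E V \<le> Suc (chi E (V - {u, v}))" using uv assms chi_le_Suc_pair by blast
    also have "chi E (V - {u, v}) \<le> card (V - {u, v})" using assms by (intro chi_le_card) auto
    also have "card (V - {u, v}) = card V - 2" using uv assms by (simp add: card_Diff_subset)
    also have "card V \<ge> card {u, v}" using uv assms by (intro card_mono) auto
    ultimately show False using eq uv by simp
  qed
next
  assume "clique E V"
  then show "chi E V = card V" using clique_le_chi[of V V] chi_le_card[of V] assms by simp
qed


subsection \<open>Counting colorings\<close>

text \<open>Restriction to \<open>S\<close> together with the color of \<open>v\<close> is a
  bijection onto the dependent sum of free colors. All later estimates for adding a vertex are
  bounds on the number of distinct colors that \<open>v\<close> sees.\<close>

lemma num_cols_insert:
  assumes "finite S" "v \<notin> S"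
  shows "num_cols E (insert v S) x = (\<Sum>g\<in>cols E S {1..x}. x - card (g ` {u \<in> S. E v u}))"
proof -
  let ?N = "{u \<in> S. E v u}"
  let ?X = "SIGMA g : cols E S {1..x}. {1..x} - g ` ?N"
  have "bij_betw (\<lambda>f. (restrict f S, f v)) (cols E (insert v S) {1..x}) ?X"
  proof (rule bij_betw_byWitness[where f' = "\<lambda>(g, c). g(v := c)"])
    show "\<forall>f\<in>cols E (insert v S) {1..x}. (\<lambda>(g, c). g(v := c)) (restrict f S, f v) = f"
    proof
      fix f assume "f \<in> cols E (insert v S) {1..x}"
      then have "f u = undefined" if "u \<notin> insert v S" for u
        using that by (simp add: cols_def PiE_def extensional_def)
      then show "(\<lambda>(g, c). g(v := c)) (restrict f S, f v) = f" by (auto simp: fun_eq_iff)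
    qed
    show "\<forall>p\<in>?X. (restrict ((\<lambda>(g, c). g(v := c)) p) S, ((\<lambda>(g, c). g(v := c)) p) v) = p"
    proof
      fix p assume "p \<in> ?X"
      then obtain g c where p: "p = (g, c)" "g \<in> cols E S {1..x}" by blast
      then have "g u = undefined" if "u \<notin> S" for u
        using that by (simp add: cols_def PiE_def extensional_def)
      then show "(restrict ((\<lambda>(g, c). g(v := c)) p) S, ((\<lambda>(g, c). g(v := c)) p) v) = p"
        using assms(2) unfolding p(1) by (auto simp: fun_eq_iff restrict_def)
    qed
    show "(\<lambda>f. (restrict f S, f v)) ` cols E (insert v S) {1..x} \<subseteq> ?X"
    proof (rule image_subsetI)
      fix f assume f: "f \<in> cols E (insert v S) {1..x}"
      then have "f v \<notin> f ` ?N" unfolding cols_def proper_def by (auto simp del: PiE_insert_eq)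
      moreover have "f v \<in> {1..x}" "\<And>u. u \<in> S \<Longrightarrow> f u \<in> {1..x}"
        using f unfolding cols_def PiE_def Pi_def by blast+
      moreover have "restrict f S ` ?N = f ` ?N" by auto
      moreover have "proper E S (restrict f S)"
        using f unfolding cols_def proper_def by (simp del: PiE_insert_eq)
      ultimately show "(restrict f S, f v) \<in> ?X" by (simp add: cols_def)
    qed
    show "(\<lambda>(g, c). g(v := c)) ` ?X \<subseteq> cols E (insert v S) {1..x}"
    proof (rule image_subsetI)
      fix p assume "p \<in> ?X"
      then obtain g c where p: "p = (g, c)" and g: "g \<in> cols E S {1..x}"
        and c: "c \<in> {1..x}" "c \<notin> g ` ?N" by blast
      have "(g(v := c)) \<in> insert v S \<rightarrow>\<^sub>E {1..x}"
        using g c by (auto simp: cols_def PiE_def extensional_def)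
      moreover have "proper E (insert v S) (g(v := c))"
        using g c assms(2) irrefl sym[of _ v] unfolding proper_def cols_def by auto
      ultimately show "(\<lambda>(g, c). g(v := c)) p \<in> cols E (insert v S) {1..x}" by (simp add: cols_def p)
    qed
  qed
  then have "num_cols E (insert v S) x = card ?X" by (rule bij_betw_same_card)
  also have "\<dots> = (\<Sum>g\<in>cols E S {1..x}. card ({1..x} - g ` ?N))"
    using assms(1) by (intro card_SigmaI finite_cols) auto
  also have "\<dots> = (\<Sum>g\<in>cols E S {1..x}. x - card (g ` ?N))"
  proof (rule sum.cong[OF refl])
    fix g assume "g \<in> cols E S {1..x}"
    then have "g ` ?N \<subseteq> {1..x}" unfolding cols_def by auto
    then show "card ({1..x} - g ` ?N) = x - card (g ` ?N)"
      using assms(1) by (subst card_Diff_subset) auto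
  qed
  finally show ?thesis .
qed

lemma num_cols_insert_le:
  assumes "finite S" "v \<notin> S" "\<And>g. g \<in> cols E S {1..x} \<Longrightarrow> m \<le> card (g ` {u \<in> S. E v u})"
  shows "num_cols E (insert v S) x \<le> num_cols E S x * (x - m)"
  unfolding num_cols_insert[OF assms(1,2)]
  using sum_bounded_above[of "cols E S {1..x}" "\<lambda>g. x - card (g ` {u \<in> S. E v u})" "x - m"] assms(3)
  by (auto simp: diff_le_mono2)

lemma num_cols_insert_le_nbr:
  assumes "finite S" "v \<notin> S" "u \<in> S" "E v u"
  shows "num_cols E (insert v S) x \<le> num_cols E S x * (x - 1)"
proof (rule num_cols_insert_le[OF assms(1,2)])
  fix g :: "'a \<Rightarrow> nat"
  have "g ` {u \<in> S. E v u} \<noteq> {}" using assms by blast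
  then have "card (g ` {u \<in> S. E v u}) \<noteq> 0" using assms(1) by simp
  then show "1 \<le> card (g ` {u \<in> S. E v u})" by linarith
qed

lemma num_cols_insert_le_two_nbrs:
  assumes "finite S" "v \<notin> S" "u \<in> S" "E v u" "w \<in> S" "E v w" "E u w"
  shows "num_cols E (insert v S) x \<le> num_cols E S x * (x - 2)"
proof (rule num_cols_insert_le[OF assms(1,2)])
  fix g assume "g \<in> cols E S {1..x}"
  then have "g u \<noteq> g w" using assms by (auto simp: cols_def proper_def)
  then have "card {g u, g w} = 2" by simp
  moreover have "card {g u, g w} \<le> card (g ` {u \<in> S. E v u})"
    using assms by (intro card_mono) auto
  ultimately show "2 \<le> card (g ` {u \<in> S. E v u})" by simp
qed

text \<open>The neighbour \<open>u\<close> bounds every summand by \<open>x - 1\<close>, and the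
  single coloring \<open>g\<close> makes one summand smaller. With \<open>x \<ge> 2\<close> the
  truncated subtraction keeps this strict.\<close>

lemma num_cols_insert_less:
  assumes "finite S" "v \<notin> S" "u \<in> S" "E v u"
    and g: "g \<in> cols E S {1..x}" "2 \<le> card (g ` {u \<in> S. E v u})" and "x \<ge> 2"
  shows "num_cols E (insert v S) x < num_cols E S x * (x - 1)"
proof -
  let ?N = "{u \<in> S. E v u}"
  have fin: "finite (cols E S {1..x})" using assms(1) by (intro finite_cols) auto
  have "(\<Sum>g\<in>cols E S {1..x}. x - card (g ` ?N)) < (\<Sum>g\<in>cols E S {1..x}. x - 1)"
  proof (rule sum_strict_mono_ex1[OF fin])
    show "\<forall>g\<in>cols E S {1..x}. x - card (g ` ?N) \<le> x - 1"
    proof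
      fix g :: "'a \<Rightarrow> nat"
      have "g ` ?N \<noteq> {}" using assms by blast
      then have "card (g ` ?N) \<noteq> 0" using assms(1) by simp
      then show "x - card (g ` ?N) \<le> x - 1" by linarith
    qed
    show "\<exists>g\<in>cols E S {1..x}. x - card (g ` ?N) < x - 1"
      using g \<open>x \<ge> 2\<close> by (intro bexI[of _ g]) auto
  qed
  then show ?thesis unfolding num_cols_insert[OF assms(1,2)] by simp
qed

lemma num_cols_insert_pendant:
  assumes "finite S" "v \<notin> S" "{u \<in> S. E v u} = {w}"
  shows "num_cols E (insert v S) x = num_cols E S x * (x - 1)"
  unfolding num_cols_insert[OF assms(1,2)] assms(3) by simp

lemma num_cols_empty: "num_cols E {} x = 1"
  by (simp add: cols_def proper_def)

lemma num_cols_clique: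
  assumes "finite Q" "clique E Q" "card Q \<le> x"
  shows "int (num_cols E Q x) = falling_factorial (int x) (card Q)"
  using assms
proof (induction Q rule: finite_induct)
  case empty
  then show ?case using num_cols_empty by (simp add: falling_factorial_def)
next
  case (insert v Q)
  have nb: "{u \<in> Q. E v u} = Q" using insert by (auto simp: clique_def)
  have "card (g ` Q) = card Q" if "g \<in> cols E Q {1..x}" for g
  proof (rule card_image)
    show "inj_on g Q" using that insert.prems(1) unfolding inj_on_def cols_def proper_def clique_def by blast
  qed
  then have "num_cols E (insert v Q) x = num_cols E Q x * (x - card Q)"
    unfolding num_cols_insert[OF insert.hyps(1,2)] nb by simp
  moreover have "clique E Q" using insert.prems(1) by (rule clique_subset) auto
  \<comment> \<open>This makes the truncated \<open>x - card Q\<close> agree with the integer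
    difference.\<close>
  moreover have "card Q < x" using insert by simp
  ultimately show ?case using insert.IH insert.hyps
    by (simp add: falling_factorial_Suc' of_nat_diff)
qed

lemma finite_nonnbrs: "finite V \<Longrightarrow> finite (nonnbrs E V v)"
  by (simp add: nonnbrs_def)

text \<open>By \<open>alpha2\<close> at most one further vertex has the color of \<open>v\<close>.
  Sorting colorings by that color and that vertex leaves colorings of the rest with the other
  \<open>x - 1\<close> colors.\<close>

lemma num_cols_le_sum_color_class:
  assumes fin: "finite V" and "alpha2 E V" and v: "v \<in> V"
  shows "num_cols E V x \<le> x * (num_cols E (V - {v}) (x - 1) +
           (\<Sum>w\<in>nonnbrs E V v. num_cols E (V - {v, w}) (x - 1)))"
proof -
  \<comment> \<open>Adding \<open>v\<close> itself lets \<open>w = v\<close> stand for the color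
    class \<open>{v}\<close>; \<open>?D c w\<close> rebuilds the colorings whose class
    \<open>{v, w}\<close> has color \<open>c\<close>.\<close>
  let ?N = "insert v (nonnbrs E V v)"
  let ?D = "\<lambda>c w. (\<lambda>g u. if u \<in> {v, w} then c else g u) ` cols E (V - {v, w}) ({1..x} - {c})"
  have finN: "finite ?N" "v \<notin> nonnbrs E V v" using fin by (auto simp: nonnbrs_def)
  have "cols E V {1..x} \<subseteq> (\<Union>c\<in>{1..x}. \<Union>w\<in>?N. ?D c w)"
  proof
    fix f assume f: "f \<in> cols E V {1..x}"
    then have f': "\<And>u. u \<in> V \<Longrightarrow> f u \<in> {1..x}" "\<And>u. u \<notin> V \<Longrightarrow> f u = undefined" 
      "\<And>u w. u \<in> V \<Longrightarrow> w \<in> V \<Longrightarrow> E u w \<Longrightarrow> f u \<noteq> f w"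
      unfolding cols_def proper_def by (auto simp: PiE_def extensional_def)
    obtain w where w: "w \<in> ?N" "\<And>u. u \<in> V \<Longrightarrow> f u = f v \<Longrightarrow> u \<in> {v, w}" "f w = f v"
    proof (cases "\<exists>w\<in>V. w \<noteq> v \<and> f w = f v")
      case True
      then obtain w where w: "w \<in> V" "w \<noteq> v" "f w = f v" by blast
      have "\<not> E v w" using w v f'(3)[of v w] by auto
      moreover have "u \<in> {v, w}" if "u \<in> V" "f u = f v" for u
        using that w v assms(2) f'(3)[of v w] f'(3)[of v u] f'(3)[of w u] unfolding alpha2_def by fastforce
      ultimately show thesis using w that[of w] by (auto simp: nonnbrs_def)
    qed (use that[of v] in auto)
    have "w \<in> V" using w(1) v by (auto simp: nonnbrs_def)
    let ?g = "restrict f (V - {v, w})"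
    have "f u \<in> {1..x} - {f v}" if "u \<in> V - {v, w}" for u
      using that f'(1)[of u] w(2)[of u] by blast
    moreover have "proper E (V - {v, w}) ?g" using f'(3) unfolding proper_def by simp
    ultimately have "?g \<in> cols E (V - {v, w}) ({1..x} - {f v})" unfolding cols_def by simp
    moreover have "f = (\<lambda>u. if u \<in> {v, w} then f v else ?g u)"
      using f'(2) w(3) v \<open>w \<in> V\<close> by (auto simp: fun_eq_iff)
    ultimately have "f \<in> ?D (f v) w" by (intro image_eqI[where x = ?g])
    then show "f \<in> (\<Union>c\<in>{1..x}. \<Union>w\<in>?N. ?D c w)" using w(1) f'(1)[OF v] by blast
  qed
  then have "num_cols E V x \<le> card (\<Union>c\<in>{1..x}. \<Union>w\<in>?N. ?D c w)"
    using fin finN by (intro card_mono finite_UN_I finite_imageI finite_cols) auto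
  also have "\<dots> \<le> (\<Sum>c\<in>{1..x}. card (\<Union>w\<in>?N. ?D c w))" by (rule card_UN_le) simp
  also have "\<dots> \<le> (\<Sum>c\<in>{1..x}. \<Sum>w\<in>?N. card (?D c w))" by (intro sum_mono card_UN_le finN)
  also have "\<dots> \<le> (\<Sum>c\<in>{1..x}. \<Sum>w\<in>?N. num_cols E (V - {v, w}) (x - 1))"
  proof (intro sum_mono)
    fix c w assume "c \<in> {1..x}"
    then have "card ({1..x} - {c}) = x - 1" by simp
    then have "card (cols E (V - {v, w}) ({1..x} - {c})) = num_cols E (V - {v, w}) (x - 1)"
      using card_cols[of "{1..x} - {c}" E "V - {v, w}"] by simp
    moreover have "card (?D c w) \<le> card (cols E (V - {v, w}) ({1..x} - {c}))"
      using fin by (intro card_image_le finite_cols) auto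
    ultimately show "card (?D c w) \<le> num_cols E (V - {v, w}) (x - 1)" by simp
  qed
  also have "\<dots> = x * (num_cols E (V - {v}) (x - 1) +
           (\<Sum>w\<in>nonnbrs E V v. num_cols E (V - {v, w}) (x - 1)))"
    using finN by simp
  finally show ?thesis .
qed


subsection \<open>Vertex-critical graphs with independence number at most 2\<close>

lemma alpha2D:
  assumes "alpha2 E V" "u \<in> V" "v \<in> V" "w \<in> V" "u \<noteq> v" "u \<noteq> w" "v \<noteq> w"
  shows "E u v \<or> E u w \<or> E v w"
  using assms unfolding alpha2_def by simp

lemma mem_nonnbrs: "w \<in> nonnbrs E V v \<longleftrightarrow> w \<in> V \<and> w \<noteq> v \<and> \<not> E v w"
  by (simp add: nonnbrs_def)

text \<open>In an optimal coloring of \<open>V - {v}\<close> the nonneighbours of \<open>v\<close>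
  are pairwise adjacent, so they have distinct colors, and each shares its color with another
  vertex. These partners are distinct and are no nonneighbours, so discarding them loses no color:
  \<open>V - {v}\<close> uses at most \<open>card V - 1 - card (nonnbrs E V v)\<close> colors, and
  \<open>v\<close> costs one more.\<close>

lemma card_nonnbrs_le_of_critical:
  assumes fin: "finite V" and "alpha2 E V" and v: "v \<in> V" and crit: "chi E (V - {v}) < chi E V"
  shows "card (nonnbrs E V v) + chi E V \<le> card V"
proof -
  let ?W = "V - {v}" and ?N = "nonnbrs E V v"
  have finW: "finite ?W" and finN: "finite ?N" using fin by (auto simp: nonnbrs_def)
  obtain f where f: "proper E ?W f" "card (f ` ?W) \<le> chi E ?W" using chi_obtain[OF finW] .
  have notN: "f w \<noteq> f u" if "w \<in> ?N" "u \<in> ?N" "w \<noteq> u" for u w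
  proof -
    have "E w u" using alpha2D[OF assms(2) v, of w u] that by (auto simp: mem_nonnbrs)
    then show ?thesis using f(1) that by (auto simp: mem_nonnbrs proper_def)
  qed
  have ex: "\<exists>u\<in>?W. u \<noteq> w \<and> f u = f w" if w: "w \<in> ?N" for w
  proof (rule ccontr)
    assume no: "\<not> ?thesis"
    then have no': "u = w" if "u \<in> V" "u \<noteq> v" "f u = f w" for u using that by blast
    \<comment> \<open>If \<open>w\<close> were alone in its color, \<open>v\<close> could join it,
      and \<open>V\<close> would need no more colors than \<open>V - {v}\<close>.\<close>
    define g where "g = f(v := f w)"
    have "proper E V g" unfolding proper_def
    proof (intro ballI impI)
      fix a b assume ab: "a \<in> V" "b \<in> V" "E a b"
      show "g a \<noteq> g b"
      proof (cases "a = v \<or> b = v")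
        case True
        then show ?thesis
          using ab no'[of a] no'[of b] w irrefl sym[of a b] unfolding g_def mem_nonnbrs by auto
      next
        case False
        then show ?thesis using ab f(1) unfolding g_def proper_def by auto
      qed
    qed
    moreover have "g ` V \<subseteq> f ` ?W" using w by (auto simp: g_def nonnbrs_def)
    then have "card (g ` V) \<le> card (f ` ?W)" using finW by (intro card_mono) auto
    ultimately have "chi E V \<le> chi E ?W" using f(2) fin by (intro chi_leI) auto
    then show False using crit by simp
  qed
  define p where "p w = (SOME u. u \<in> ?W \<and> u \<noteq> w \<and> f u = f w)" for w
  have p: "p w \<in> ?W" "p w \<noteq> w" "f (p w) = f w" if "w \<in> ?N" for w
    using someI_ex[of "\<lambda>u. u \<in> ?W \<and> u \<noteq> w \<and> f u = f w"] ex[OF that] unfolding p_def by blast+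
  have pN: "p w \<notin> ?N" if "w \<in> ?N" for w using p[OF that] notN that by metis
  have inj: "inj_on p ?N" using p(3) notN unfolding inj_on_def by metis
  \<comment> \<open>Dropping all partners keeps every color, since \<open>w\<close> itself still
    shows the color of \<open>p w\<close>.\<close>
  let ?R = "?W - p ` ?N"
  have NR: "?N \<subseteq> ?R" using pN unfolding nonnbrs_def by auto
  have "f ` ?W \<subseteq> f ` ?R"
  proof (rule image_subsetI)
    fix u assume u: "u \<in> ?W"
    show "f u \<in> f ` ?R"
    proof (cases "u \<in> p ` ?N")
      case True
      then obtain w where w: "w \<in> ?N" "u = p w" by blast
      then have "f u = f w" using p(3) by simp
      then show ?thesis using NR w(1) by (metis imageI subsetD)
    next
      case False
      then show ?thesis using u by simp
    qed
  qed
  then have "card (f ` ?W) \<le> card (f ` ?R)" using finW by (intro card_mono) auto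
  also have "\<dots> \<le> card ?R" using finW by (intro card_image_le) auto
  also have "\<dots> = card ?W - card ?N"
    using p(1) finN by (subst card_Diff_subset) (auto simp: card_image[OF inj])
  finally have le: "card (f ` ?W) \<le> card ?W - card ?N" .
  have "card ?N \<le> card ?W" using finW by (intro card_mono) (auto simp: nonnbrs_def)
  moreover have "card ?W = card V - 1" "card V > 0" using v fin card_gt_0_iff by auto
  moreover have "chi E V \<le> Suc (card (f ` ?W))"
    using chi_le_Suc[OF fin, of v] chi_leI[OF finW f(1) order_refl] by simp
  ultimately show ?thesis using le by linarith
qed

text \<open>If \<open>w\<close> were the only nonneighbour of \<open>v\<close>, then in a coloring
  of \<open>V - {w}\<close> the color of \<open>v\<close> would occur only at \<open>v\<close>.
  Giving it to \<open>w\<close> as well contradicts criticality at \<open>w\<close>.\<close>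

lemma card_nonnbrs_neq_1_of_critical:
  assumes fin: "finite V" and crit: "\<And>u. u \<in> V \<Longrightarrow> chi E (V - {u}) < chi E V" and v: "v \<in> V"
  shows "card (nonnbrs E V v) \<noteq> 1"
proof
  assume "card (nonnbrs E V v) = 1"
  then obtain w where w: "nonnbrs E V v = {w}" using card_1_singletonE by blast
  then have "w \<in> nonnbrs E V v" by blast
  then have wV: "w \<in> V" "w \<noteq> v" "\<not> E v w" by (auto simp: nonnbrs_def)
  have nb: "E v u" if "u \<in> V" "u \<noteq> v" "u \<noteq> w" for u
    using w that unfolding nonnbrs_def by blast
  let ?W = "V - {w}"
  have finW: "finite ?W" using fin by simp
  obtain f where f: "proper E ?W f" "card (f ` ?W) \<le> chi E ?W" using chi_obtain[OF finW] .
  define g where "g = f(w := f v)"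
  have "proper E V g" unfolding proper_def
  proof (intro ballI impI)
    fix a b assume ab: "a \<in> V" "b \<in> V" "E a b"
    have fv: "f v \<noteq> f u" if "u \<in> V" "u \<noteq> v" "u \<noteq> w" for u
      using f(1) nb[OF that] that v wV unfolding proper_def by blast
    show "g a \<noteq> g b"
    proof (cases "a = w \<or> b = w")
      case True
      then show ?thesis using ab wV irrefl sym[of a b] fv[of a] fv[of b] unfolding g_def
        by (cases "a = v"; cases "b = v") auto
    next
      case False
      then show ?thesis using ab f(1) unfolding g_def proper_def by auto
    qed
  qed
  moreover have "g ` V \<subseteq> f ` ?W" using v wV by (auto simp: g_def)
  then have "card (g ` V) \<le> card (f ` ?W)" using finW by (intro card_mono) auto
  ultimately have "chi E V \<le> chi E ?W" using f(2) fin by (intro chi_leI) auto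
  then show False using crit[OF wV(1)] by simp
qed

text \<open>A nonadjacent pair among the other vertices would form an independent triple with
  \<open>v\<close>.\<close>

lemma isolated_imp_clique:
  assumes "alpha2 E V" "v \<in> V" "\<And>u. u \<in> V \<Longrightarrow> \<not> E v u"
  shows "clique E (V - {v})"
  unfolding clique_def
proof (intro ballI impI)
  fix a b assume "a \<in> V - {v}" "b \<in> V - {v}" "a \<noteq> b"
  then show "E a b" using alpha2D[OF assms(1,2), of a b] assms(3) by auto
qed

lemma chi_pos:
  assumes "finite V" "v \<in> V"
  shows "chi E V > 0"
proof (rule ccontr)
  assume "\<not> chi E V > 0"
  moreover obtain f where "proper E V f" "card (f ` V) \<le> chi E V" using chi_obtain[OF assms(1)] .
  ultimately show False using assms by auto
qed

lemma exists_nonnbr: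
  assumes "finite V" "chi E V < card V"
  obtains v w where "v \<in> V" "w \<in> nonnbrs E V v"
proof -
  have "\<not> clique E V" using assms chi_eq_card_iff by fastforce
  then show thesis using that unfolding clique_def mem_nonnbrs by metis
qed

text \<open>A vertex with a nonneighbour has at least two of them, and their number is at most the
  deficiency \<open>card V - chi E V\<close>.\<close>

lemma critical_deficiency_ge_2:
  assumes fin: "finite V" and "alpha2 E V" and crit: "\<And>u. u \<in> V \<Longrightarrow> chi E (V - {u}) < chi E V"
    and "chi E V < card V"
  shows "chi E V + 2 \<le> card V"
proof -
  obtain v w where vw: "v \<in> V" "w \<in> nonnbrs E V v" using exists_nonnbr[OF fin assms(4)] .
  have "card (nonnbrs E V v) \<noteq> 0" using vw fin finite_nonnbrs by auto
  moreover have "card (nonnbrs E V v) \<noteq> 1" using card_nonnbrs_neq_1_of_critical[OF fin crit vw(1)] .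
  moreover have "card (nonnbrs E V v) + chi E V \<le> card V"
    using card_nonnbrs_le_of_critical[OF fin assms(2) vw(1) crit[OF vw(1)]] .
  ultimately show ?thesis by linarith
qed

lemma critical_chi_Diff:
  assumes "finite V" "v \<in> V" "chi E (V - {v}) < chi E V"
  shows "chi E V = Suc (chi E (V - {v}))"
  using assms chi_le_Suc[of V v] by linarith

text \<open>Since \<open>v\<close> and \<open>w\<close> can share a color, deleting both lowers the
  chromatic number no further than deleting \<open>v\<close>. Hence the deficiency drops by exactly
  one, while deleting \<open>v\<close> alone preserves it.\<close>

lemma critical_chi_Diff_nonnbr:
  assumes "finite V" "v \<in> V" "chi E (V - {v}) < chi E V" "w \<in> nonnbrs E V v"
  shows "chi E V = Suc (chi E (V - {v, w}))" "card V = card (V - {v, w}) + 2"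
proof -
  have w: "w \<in> V" "w \<noteq> v" "\<not> E v w" using assms(4) by (auto simp: nonnbrs_def)
  have "chi E (V - {v, w}) \<le> chi E (V - {v})" using assms by (intro chi_mono) auto
  then show "chi E V = Suc (chi E (V - {v, w}))"
    using chi_le_Suc_pair[OF assms(1) w(3)] assms(3) by linarith
  have "card V \<ge> card {v, w}" using assms w by (intro card_mono) auto
  then show "card V = card (V - {v, w}) + 2"
    using w assms(1,2) by (simp add: card_Diff_subset)
qed

end

section \<open>Two numerical inequalities\<close>

text \<open>Serves the weak bound with \<open>s = x - 2\<close> and \<open>m = \<nu> - 2\<close>:
  the class \<open>{v}\<close> contributes \<open>s ^ (m + 1)\<close> and at most
  \<open>m + 2\<close> pair classes contribute \<open>s ^ m\<close> each.\<close>

lemma power_mult_le_power: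
  fixes s :: int
  assumes "s \<ge> 0"
  shows "s ^ m * (s + 2 + int m) \<le> (s + 2) * (s + 1) ^ m"
proof (induction m)
  case (Suc m)
  have "s ^ Suc m * (s + 2 + int (Suc m)) \<le> (s + 1) * (s ^ m * (s + 2 + int m))"
  proof -
    have "(s + 1) * (s ^ m * (s + 2 + int m)) - s ^ Suc m * (s + 2 + int (Suc m)) = s ^ m * (2 + int m)"
      by (simp add: algebra_simps)
    moreover have "s ^ m * (2 + int m) \<ge> 0" using assms by simp
    ultimately show ?thesis by linarith
  qed
  also have "\<dots> \<le> (s + 1) * ((s + 2) * (s + 1) ^ m)"
    using Suc assms by (intro mult_left_mono) auto
  finally show ?case by (simp add: algebra_simps)
qed simp

text \<open>Serves the strict bound with \<open>s = x - 2\<close> and \<open>m = \<nu> - 3\<close>.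
  For exponent 3 the two sides differ by exactly 1; for exponent 2 the analogous inequality fails,
  so deficiency 2 has to be excluded by structure.\<close>

lemma power_add_less_power:
  fixes s :: int
  assumes "s \<ge> 0"
  shows "s ^ (m + 3) + (int m + 3) * (s + 1) * s ^ (m + 1) < (s + 1) ^ (m + 3)"
proof (induction m)
  case 0
  show ?case by (simp add: algebra_simps power3_eq_cube)
next
  case (Suc m)
  have "s ^ (Suc m + 3) + (int (Suc m) + 3) * (s + 1) * s ^ (Suc m + 1)
      \<le> (s + 1) * (s ^ (m + 3) + (int m + 3) * (s + 1) * s ^ (m + 1))"
  proof -
    have "(s + 1) * (s ^ (m + 3) + (int m + 3) * (s + 1) * s ^ (m + 1)) -
       (s ^ (Suc m + 3) + (int (Suc m) + 3) * (s + 1) * s ^ (Suc m + 1))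
       = s ^ (m + 1) * ((int m + 2) * s + int m + 3)"
      by (simp add: algebra_simps power3_eq_cube power2_eq_square power4_eq_xxxx power_add)
    moreover have "s ^ (m + 1) * ((int m + 2) * s + int m + 3) \<ge> 0" using assms by simp
    ultimately show ?thesis by linarith
  qed
  also have "\<dots> < (s + 1) * (s + 1) ^ (m + 3)"
    using Suc assms by (intro mult_strict_left_mono) auto
  also have "\<dots> = (s + 1) ^ (Suc m + 3)" by (simp only: add_Suc power_Suc)
  finally show ?case .
qed

lemma int_le_mult_diff:
  assumes "a \<le> b * (x - m)" "m \<le> x"
  shows "int a \<le> int b * (int x - int m)"
proof -
  have "int a \<le> int (b * (x - m))" using assms(1) by (simp only: of_nat_le_iff)
  then show ?thesis using assms(2) by (simp add: of_nat_diff)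
qed

section \<open>The weak bound, valid for disconnected graphs\<close>

context adjacency begin

text \<open>The disjoint union of cliques with \<open>k\<close> and \<open>1\<close> vertices attains this bound.\<close>

lemma num_cols_le_weak:
  assumes "finite V" "alpha2 E V" "chi E V \<le> x" "chi E V < card V"
  shows "int (num_cols E V x) \<le> falling_factorial (int x) (chi E V) * int x * (int x - 1) ^ (card V - chi E V - 1)"
  using assms
proof (induction "card V" arbitrary: V x rule: less_induct)
  case less
  note fin = less.prems(1) and al = less.prems(2)
  let ?k = "chi E V" and ?ff = "falling_factorial (int x) (chi E V)"
  have ff0: "?ff > 0" using falling_factorial_pos less.prems(3) by blast
  show ?case
  proof (cases "\<exists>v\<in>V. chi E (V - {v}) = chi E V")
    case True
    then obtain v where v: "v \<in> V" "chi E (V - {v}) = ?k" by blast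
    let ?W = "V - {v}"
    have W: "finite ?W" "alpha2 E ?W" "insert v ?W = V" "v \<notin> ?W" "card V = Suc (card ?W)"
      using fin al v card_Suc_Diff1[OF fin v(1)] by (auto intro: alpha2_subset)
    show ?thesis
    \<comment> \<open>If the rest is a clique, \<open>v\<close> may be isolated and costs a full
      factor \<open>x\<close>, the extra factor of the bound. Otherwise \<open>v\<close> has a
      neighbour and costs only \<open>x - 1\<close>.\<close>
    proof (cases "clique E ?W")
      case True
      then have c: "card ?W = ?k" using chi_eq_card_iff[OF W(1)] v by simp
      have "num_cols E V x \<le> num_cols E ?W x * (x - 0)"
        using num_cols_insert_le[OF W(1,4), of x 0] W(3) by simp
      then have "int (num_cols E V x) \<le> int (num_cols E ?W x) * int x"
        using int_le_mult_diff[of _ _ x 0] by simp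
      also have "int (num_cols E ?W x) = ?ff"
        using num_cols_clique[OF W(1) True] c less.prems(3) by simp
      finally show ?thesis using c W(5) by simp
    next
      case False
      then obtain u where u: "u \<in> ?W" "E v u"
        using isolated_imp_clique[OF al v(1)] irrefl by blast
      have lt: "?k < card ?W" using False chi_eq_card_iff[OF W(1)] chi_le_card[OF W(1)] v by fastforce
      then have e: "card V - ?k - 1 = Suc (card ?W - ?k - 1)" using W(5) by linarith
      have "?k \<noteq> 0" using chi_pos[OF fin v(1)] by simp
      then have x1: "x \<ge> 1" using less.prems(3) by linarith
      have "num_cols E V x \<le> num_cols E ?W x * (x - 1)"
        using num_cols_insert_le_nbr[OF W(1,4) u, of x] W(3) by simp
      then have "int (num_cols E V x) \<le> int (num_cols E ?W x) * (int x - 1)"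
        using int_le_mult_diff[of _ _ x 1] x1 by simp
      also have "\<dots> \<le> (?ff * int x * (int x - 1) ^ (card ?W - ?k - 1)) * (int x - 1)"
        using less.hyps[OF _ W(1,2)] W(5) v(2) less.prems(3) lt x1 by (intro mult_right_mono) auto
      also have "\<dots> = ?ff * int x * (int x - 1) ^ (card V - ?k - 1)" unfolding e by simp
      finally show ?thesis .
    qed
  next
    case False
    then have crit: "chi E (V - {u}) < chi E V" if "u \<in> V" for u
      using that chi_mono[of V "V - {u}"] fin by fastforce
    have nu2: "?k + 2 \<le> card V" using critical_deficiency_ge_2[OF fin al crit less.prems(4)] .
    obtain v w0 where v: "v \<in> V" and w0: "w0 \<in> nonnbrs E V v" using exists_nonnbr[OF fin less.prems(4)] .
    define m where "m = card V - ?k - 2"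
    define j where "j = chi E (V - {v})"
    have k: "?k = Suc j" using critical_chi_Diff[OF fin v crit[OF v]] by (simp add: j_def)
    have x1: "x \<ge> 1" and jx: "j \<le> x - 1" using k less.prems(3) by auto
    \<comment> \<open>Removing a color class lowers both the chromatic number and the palette by
      one, which is how the falling factorial splits.\<close>
    have ffk: "?ff = int x * falling_factorial (int x - 1) j" unfolding k falling_factorial_Suc ..
    have x': "int (x - 1) = int x - 1" using x1 by simp
    let ?t = "int x - 1" and ?f = "falling_factorial (int x - 1) j"
    have "w0 \<in> V - {v}" using w0 by (simp add: mem_nonnbrs)
    then have "j > 0" using chi_pos fin unfolding j_def by blast
    then have t1: "?t \<ge> 1" using jx by simp
    have f0: "?f \<ge> 0" using falling_factorial_pos[OF jx] x' by simp
    have cW: "card V = Suc (card (V - {v}))" using card_Suc_Diff1[OF fin v] by simp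
    have e1: "card (V - {v}) - j - 1 = Suc m" "j < card (V - {v})" using cW k nu2 unfolding m_def by auto
    \<comment> \<open>The set \<open>V - {v}\<close> keeps deficiency \<open>m + 2\<close>, which
      gives exponent \<open>m + 1\<close>; the sets \<open>V - {v, w}\<close> have deficiency
      \<open>m + 1\<close>, which gives exponent \<open>m\<close>.\<close>
    have "int (num_cols E (V - {v}) (x - 1)) \<le> ?f * ?t * (?t - 1) ^ Suc m"
      using less.hyps[of "V - {v}" "x - 1"] cW fin al jx e1 alpha2_subset[OF al, of "V - {v}"]
      unfolding x' j_def[symmetric] by simp
    moreover have "int (num_cols E (V - {v, w}) (x - 1)) \<le> ?f * ?t * (?t - 1) ^ m" if w: "w \<in> nonnbrs E V v" for w
    proof -
      note c = critical_chi_Diff_nonnbr[OF fin v crit[OF v] w]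
      have c1: "chi E (V - {v, w}) = j" using c(1) k by simp
      have c2: "card (V - {v, w}) - j - 1 = m" "card (V - {v, w}) < card V" "j < card (V - {v, w})"
        using c(2) nu2 k unfolding m_def by auto
      show ?thesis
        using less.hyps[of "V - {v, w}" "x - 1"] fin al jx c1 c2 nu2 c(2) k alpha2_subset[OF al, of "V - {v, w}"]
        unfolding x' by auto
    qed
    ultimately have "int (num_cols E (V - {v}) (x - 1) +
           (\<Sum>w\<in>nonnbrs E V v. num_cols E (V - {v, w}) (x - 1)))
        \<le> ?f * ?t * (?t - 1) ^ Suc m + of_nat (card (nonnbrs E V v)) * (?f * ?t * (?t - 1) ^ m)"
      unfolding of_nat_add of_nat_sum by (intro add_mono sum_bounded_above) auto
    also have "\<dots> \<le> ?f * ?t * (?t - 1) ^ Suc m + int (m + 2) * (?f * ?t * (?t - 1) ^ m)"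
    proof (intro add_left_mono mult_right_mono)
      show "of_nat (card (nonnbrs E V v)) \<le> int (m + 2)"
        using card_nonnbrs_le_of_critical[OF fin al v crit[OF v]] nu2 unfolding m_def by simp
    qed (use f0 t1 in simp)
    also have "\<dots> = ?f * ?t * ((?t - 1) ^ m * ((?t - 1) + 2 + int m))"
      by (simp add: algebra_simps)
    also have "\<dots> \<le> ?f * ?t * (((?t - 1) + 2) * ((?t - 1) + 1) ^ m)"
      using f0 t1 by (intro mult_left_mono power_mult_le_power) auto
    finally have "int x * int (num_cols E (V - {v}) (x - 1) +
           (\<Sum>w\<in>nonnbrs E V v. num_cols E (V - {v, w}) (x - 1)))
        \<le> int x * (?f * ?t * (((?t - 1) + 2) * ((?t - 1) + 1) ^ m))"
      by (rule mult_left_mono) simp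
    also have "\<dots> = ?ff * int x * ?t ^ Suc m" unfolding ffk by (simp add: algebra_simps)
    also have "Suc m = card V - ?k - 1" using nu2 unfolding m_def by simp
    finally show ?thesis
      using num_cols_le_sum_color_class[OF fin al v, of x]
      unfolding of_nat_le_iff[symmetric, where ?'a = int] of_nat_mult by (rule order_trans[rotated])
  qed
qed


section \<open>Triangles, and matchings in the complement\<close>

lemma clique_nonnbrs:
  assumes "alpha2 E V" "v \<in> V"
  shows "clique E (nonnbrs E V v)"
  unfolding clique_def
proof (intro ballI impI)
  fix a b assume "a \<in> nonnbrs E V v" "b \<in> nonnbrs E V v" "a \<noteq> b"
  then show "E a b" using alpha2D[OF assms, of a b] by (auto simp: mem_nonnbrs)
qed

text \<open>This is the Ramsey number R(3,3) = 6. Three nonneighbours of a vertex \<open>v\<close>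
  are pairwise adjacent; among three neighbours two are adjacent and form a triangle with
  \<open>v\<close>.\<close>

lemma exists_triangle:
  assumes fin: "finite V" and al: "alpha2 E V" and "card V \<ge> 6"
  obtains Q where "Q \<subseteq> V" "clique E Q" "card Q = 3"
proof -
  note found = that
  obtain v where v: "v \<in> V" using assms(3) by fastforce
  let ?M = "nonnbrs E V v" and ?N = "{u \<in> V. E v u}"
  have V: "V = insert v (?M \<union> ?N)" using v by (auto simp: nonnbrs_def)
  have "card V \<le> Suc (card (?M \<union> ?N))" by (subst V) (rule card_insert_le_m1, auto)
  also have "card (?M \<union> ?N) \<le> card ?M + card ?N" by (rule card_Un_le)
  finally consider "card ?M \<ge> 3" | "card ?N \<ge> 3" using assms(3) by linarith
  then show thesis
  proof cases
    case 1
    then obtain Q where "Q \<subseteq> ?M" "card Q = 3" by (meson obtain_subset_with_card_n)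
    moreover have "?M \<subseteq> V" by (auto simp: nonnbrs_def)
    ultimately show thesis using clique_subset[OF clique_nonnbrs[OF al v]] that[of Q] by blast
  next
    case 2
    then obtain Q where Q: "Q \<subseteq> ?N" "card Q = 3" by (meson obtain_subset_with_card_n)
    then obtain a b c where abc: "Q = {a, b, c}" "a \<noteq> b" "a \<noteq> c" "b \<noteq> c" using card_3_iff by metis
    then have m: "a \<in> V" "b \<in> V" "c \<in> V" "E v a" "E v b" "E v c" using Q by auto
    have tri: thesis if "E p q" "p \<in> V" "q \<in> V" "E v p" "E v q" for p q
    proof -
      have "p \<noteq> q" "v \<noteq> p" "v \<noteq> q" using that irrefl by auto
      then have "clique E {v, p, q}" "card {v, p, q} = 3" using that sym unfolding clique_def by auto
      then show thesis using found[of "{v, p, q}"] that v by simp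
    qed
    show thesis using alpha2D[OF al m(1-3) abc(2-4)] tri m by blast
  qed
qed

text \<open>Each edge of a matching of size 3 in the complement lets two vertices share a color and
  so saves one color.\<close>

lemma chi_le_three_pairs:
  assumes fin: "finite V" and sub: "{a, b, c, d, e, f} \<subseteq> V" and dist: "distinct [a, b, c, d, e, f]"
    and "\<not> E a b" "\<not> E c d" "\<not> E e f"
  shows "chi E V + 3 \<le> card V"
proof -
  let ?W1 = "V - {a, b}" let ?W2 = "?W1 - {c, d}" let ?W3 = "?W2 - {e, f}"
  have "chi E V \<le> Suc (chi E ?W1)" using assms by (intro chi_le_Suc_pair) auto
  also have "chi E ?W1 \<le> Suc (chi E ?W2)" using assms by (intro chi_le_Suc_pair) auto
  also have "chi E ?W2 \<le> Suc (chi E ?W3)" using assms by (intro chi_le_Suc_pair) auto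
  also have "chi E ?W3 \<le> card ?W3" using fin by (intro chi_le_card) auto
  also have "?W3 = V - {a, b, c, d, e, f}" by auto
  finally have "chi E V \<le> card (V - {a, b, c, d, e, f}) + 3" by simp
  moreover have "card {a, b, c, d, e, f} = 6" using dist by simp
  moreover have "card {a, b, c, d, e, f} \<le> card V" using fin sub by (intro card_mono)
  moreover have "card (V - {a, b, c, d, e, f}) = card V - card {a, b, c, d, e, f}"
    using sub by (intro card_Diff_subset) auto
  ultimately show ?thesis by linarith
qed

text \<open>The complement is 2-regular and triangle-free, so it has a matching of size 3 as soon as
  it has at least six vertices.\<close>

lemma chi_le_of_two_nonnbrs:
  assumes fin: "finite V" and al: "alpha2 E V" and two: "\<And>u. u \<in> V \<Longrightarrow> card (nonnbrs E V u) = 2"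
    and "card V \<ge> 6"
  shows "chi E V + 3 \<le> card V"
proof -
  let ?H = "nonnbrs E V"
  have symH: "u \<in> ?H w" if "w \<in> ?H u" "u \<in> V" for u w
    using that sym[of w u] by (auto simp: mem_nonnbrs)
  have inV: "w \<in> V" "w \<noteq> u" "\<not> E u w" "\<not> E w u" if "w \<in> ?H u" for u w
    using that sym[of w u] by (auto simp: mem_nonnbrs)
  have no_tri: "\<not> (b \<in> ?H a \<and> c \<in> ?H a \<and> c \<in> ?H b)" if "a \<in> V" for a b c
    using alpha2D[OF al that, of b c] by (auto simp: mem_nonnbrs)
  have other: "\<exists>w. ?H u = {y, w} \<and> w \<noteq> y" if "u \<in> V" "y \<in> ?H u" for u y
    using two[OF that(1)] that(2) unfolding card_2_iff by (metis doubleton_eq_iff insertE singletonD)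
  obtain v where v: "v \<in> V" using assms(4) by fastforce
  obtain a b where ab: "?H v = {a, b}" "a \<noteq> b" using two[OF v] card_2_iff by metis
  have a: "a \<in> V" "a \<noteq> v" "v \<in> ?H a" and b: "b \<in> V" "b \<noteq> v" "v \<in> ?H b"
    using inV[of a v] inV[of b v] ab symH[of a v] symH[of b v] v by auto
  \<comment> \<open>In the complement \<open>c - a - v - b - d\<close> is a walk;
    \<open>c = d\<close> is still possible at this point.\<close>
  obtain c where c: "?H a = {v, c}" "c \<noteq> v" using other[OF a(1,3)] by blast
  obtain d where d: "?H b = {v, d}" "d \<noteq> v" using other[OF b(1,3)] by blast
  have c': "c \<in> V" "c \<noteq> a" "c \<noteq> b" "a \<in> ?H c"
    using inV[of c a] c symH[of c a] a no_tri[OF v, of a b] ab by auto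
  have d': "d \<in> V" "d \<noteq> b" "d \<noteq> a" "b \<in> ?H d"
    using inV[of d b] d symH[of d b] b no_tri[OF v, of b a] ab by auto
  have "card {v, a, b, c, d} \<le> 5" by (simp add: card_insert_if)
  then have "\<not> V \<subseteq> {v, a, b, c, d}" using assms(4) card_mono[of "{v, a, b, c, d}" V] by auto
  \<comment> \<open>The walk has at most five vertices, so some vertex \<open>p\<close> lies off it;
    a complement edge \<open>pq\<close> will be the first matching edge.\<close>
  then obtain p where p: "p \<in> V" "p \<notin> {v, a, b, c, d}" by blast
  have "?H p \<noteq> {}" using two[OF p(1)] by auto
  then have pn: "q \<notin> {v, a, b}" if "q \<in> ?H p" for q
    using symH[OF that p(1)] ab c d p(2) by auto
  obtain q where q: "q \<in> ?H p" using \<open>?H p \<noteq> {}\<close> by blast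
  have q': "q \<in> V" "q \<noteq> p" "\<not> E p q" using inV[OF q] by auto
  have ne: "\<not> E v a" "\<not> E v b" "\<not> E a c" "\<not> E b d"
    using inV(3)[of a v] inV(3)[of b v] inV(3)[of c a] inV(3)[of d b] ab c d by auto
  \<comment> \<open>The matching is \<open>pq\<close>, \<open>va\<close>, \<open>bd\<close> if
    \<open>q = c\<close>, and \<open>pq\<close>, \<open>ac\<close>, \<open>vb\<close>
    otherwise.\<close>
  show ?thesis
  proof (cases "q = c")
    case qc: True
    \<comment> \<open>Otherwise \<open>c\<close> would have the three nonneighbours
      \<open>a\<close>, \<open>b\<close> and \<open>p\<close>.\<close>
    have "d \<noteq> c"
    proof
      assume "d = c"
      then have "{a, b, p} \<subseteq> ?H c" using c' d' symH[OF q p(1)] qc by auto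
      moreover have "card {a, b, p} = 3" using ab(2) p(2) by auto
      ultimately have "3 \<le> card (?H c)" by (metis card_mono fin finite_nonnbrs)
      then show False using two[OF c'(1)] by simp
    qed
    show ?thesis
    proof (rule chi_le_three_pairs[OF fin])
      show "distinct [p, q, v, a, b, d]"
        using a(2) b(2) c'(2,3) d'(2,3) d(2) c(2) ab(2) p(2) q'(2) qc \<open>d \<noteq> c\<close> by auto
    qed (use v a(1) b(1) c'(1) d'(1) p(1) q' qc ne in simp_all)
  next
    case False
    show ?thesis
    proof (rule chi_le_three_pairs[OF fin])
      show "distinct [p, q, a, c, v, b]"
        using a(2) b(2) c'(2,3) c(2) ab(2) p(2) q'(2) pn[OF q] False by auto
    qed (use v a(1) b(1) c'(1) p(1) q' ne in simp_all)
  qed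
qed

section \<open>Growing a coloring in a connected graph\<close>

text \<open>Connectivity always offers a new vertex with a neighbour already colored. The start
  \<open>S\<close> is arbitrary, not just a clique, because the equality case applies this to
  intermediate sets.\<close>

lemma num_cols_le_extend:
  assumes fin: "finite V" and "conn E V" and "S \<subseteq> V" "S \<noteq> {}" and "x \<ge> 1"
  shows "int (num_cols E V x) \<le> int (num_cols E S x) * (int x - 1) ^ (card V - card S)"
  using assms(3,4)
proof (induction "card V - card S" arbitrary: S)
  case 0
  then have "S = V" using fin by (metis card_seteq diff_is_0_eq)
  then show ?case by simp
next
  case (Suc m)
  then have "S \<subset> V" using fin by auto
  then obtain u v where uv: "u \<in> S" "v \<in> V" "v \<notin> S" "E u v"
    using assms(2) Suc.prems(2) unfolding conn_def by blast
  have finS: "finite S" using fin Suc.prems by (metis finite_subset)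
  have c: "card (insert v S) = Suc (card S)" using uv finS by simp
  have "num_cols E (insert v S) x \<le> num_cols E S x * (x - 1)"
    using num_cols_insert_le_nbr[OF finS uv(3,1) sym[OF uv(4)]] .
  then have le: "int (num_cols E (insert v S) x) \<le> int (num_cols E S x) * (int x - 1)"
    using int_le_mult_diff[of _ _ x 1] assms(5) by simp
  have "int (num_cols E V x) \<le> int (num_cols E (insert v S) x) * (int x - 1) ^ (card V - card (insert v S))"
    using Suc.hyps(2) Suc.prems uv c by (intro Suc.hyps(1)) auto
  also have "\<dots> \<le> int (num_cols E S x) * (int x - 1) * (int x - 1) ^ (card V - card (insert v S))"
    using le assms(5) by (intro mult_right_mono) auto
  also have "\<dots> = int (num_cols E S x) * (int x - 1) ^ Suc (card V - card (insert v S))" by simp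
  also have "Suc (card V - card (insert v S)) = card V - card S" using c Suc.hyps(2) by simp
  finally show ?case .
qed

lemma num_cols_le_of_clique:
  assumes "finite V" "conn E V" "Q \<subseteq> V" "Q \<noteq> {}" "clique E Q" "card Q \<le> x"
  shows "int (num_cols E V x) \<le> falling_factorial (int x) (card Q) * (int x - 1) ^ (card V - card Q)"
proof -
  have finQ: "finite Q" using assms(1,3) by (metis finite_subset)
  then have "card Q \<noteq> 0" using assms(4) by simp
  then have "x \<ge> 1" using assms(6) by linarith
  then show ?thesis
    using num_cols_le_extend[OF assms(1-4), of x] num_cols_clique[OF finQ assms(5,6)] by simp
qed

text \<open>The components of \<open>V - {v}\<close> are cliques \<open>S\<close> and \<open>T\<close>, and \<open>v\<close> is joined to all of one of
  them. Each vertex of \<open>S\<close> has all of \<open>T\<close> as nonneighbours and vice versa, so criticality makes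
  both sides large.\<close>

lemma clique_of_disconnected_Diff:
  assumes fin: "finite V" and al: "alpha2 E V" and crit: "\<And>u. u \<in> V \<Longrightarrow> chi E (V - {u}) < chi E V"
    and v: "v \<in> V" and "\<not> conn E (V - {v})"
  obtains Q where "Q \<subseteq> V" "clique E Q" "chi E V \<le> card Q"
proof -
  note found = that
  let ?W = "V - {v}"
  obtain S where S: "S \<noteq> {}" "S \<subset> ?W" "\<And>a b. a \<in> S \<Longrightarrow> b \<in> ?W - S \<Longrightarrow> \<not> E a b"
    using assms(5) unfolding conn_def by blast
  \<comment> \<open>Stated for an arbitrary split, so that either side can be the one joined
    completely to \<open>v\<close>.\<close>
  have main: thesis if S: "S \<noteq> {}" "T \<noteq> {}" "S \<union> T = ?W" "S \<inter> T = {}"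
    and no: "\<And>a b. a \<in> S \<Longrightarrow> b \<in> T \<Longrightarrow> \<not> E a b" and vS: "\<And>a. a \<in> S \<Longrightarrow> E v a" for S T
  proof -
    obtain t where t: "t \<in> T" using S by blast
    have tV: "t \<in> V" "t \<notin> S" "S \<subseteq> V" "v \<notin> S" using t S by auto
    have finS: "finite S" "finite T" using fin S(3) by (metis finite_Diff finite_Un)+
    have clS: "E a b" if "a \<in> S" "b \<in> S" "a \<noteq> b" for a b
      using alpha2D[OF al, of t a b] no[OF _ t] that tV sym[of t a] sym[of t b] by auto
    have "clique E (insert v S)" unfolding clique_def using clS vS sym by auto
    moreover have "insert v S \<subseteq> V" using v tV by simp
    moreover have "chi E V \<le> card (insert v S)"
    proof -
      obtain s where s: "s \<in> S" using S by blast
      \<comment> \<open>The vertex \<open>s\<close> misses all of \<open>T\<close>, so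
        \<open>card T + chi E V \<le> card V = card S + card T + 1\<close>; hence
        \<open>insert v S\<close> is large enough.\<close>
      have "T \<subseteq> nonnbrs E V s" using no[OF s] S s by (auto simp: mem_nonnbrs)
      then have "card T \<le> card (nonnbrs E V s)" using fin by (intro card_mono finite_nonnbrs) auto
      moreover have "card (nonnbrs E V s) + chi E V \<le> card V"
        using card_nonnbrs_le_of_critical[OF fin al _ crit] s tV by blast
      moreover have "card V = Suc (card S + card T)"
        using card_Suc_Diff1[OF fin v] S(3) card_Un_disjoint[OF finS S(4)] by simp
      moreover have "card (insert v S) = Suc (card S)" using finS tV by simp
      ultimately show ?thesis by linarith
    qed
    ultimately show thesis using found by blast
  qed
  let ?T = "?W - S"
  show thesis
  proof (cases "\<forall>a\<in>S. E v a")
    case True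
    then show thesis using main[of S ?T] S by blast
  next
    case False
    then obtain s where s: "s \<in> S" "\<not> E v s" by blast
    \<comment> \<open>If \<open>v\<close> misses some \<open>s\<close> in \<open>S\<close>, every
      \<open>b\<close> on the other side must see \<open>v\<close>, or \<open>v\<close>,
      \<open>s\<close>, \<open>b\<close> would be independent.\<close>
    have vT: "E v b" if "b \<in> ?T" for b
      using alpha2D[OF al v, of s b] s S that by auto
    have "\<not> E a b" if "a \<in> ?T" "b \<in> S" for a b using S(3)[OF that(2,1)] sym by blast
    then show thesis using main[of ?T S] S vT by blast
  qed
qed


section \<open>The strict inequality in the absence of a k-clique\<close>

text \<open>Here \<open>v\<close> is isolated in the complement, so its color class is always
  \<open>{v}\<close>. The weak bound for \<open>V - {v}\<close> with \<open>x - 1\<close> colors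
  suffices, and strictness comes from replacing the base \<open>x - 2\<close> by
  \<open>x - 1\<close> under a positive exponent.\<close>

lemma critical_num_cols_less_of_isolated:
  assumes fin: "finite V" and al: "alpha2 E V" and x: "chi E V \<le> x"
    and crit: "\<And>u. u \<in> V \<Longrightarrow> chi E (V - {u}) < chi E V" and lt: "chi E V + 2 \<le> card V"
    and v: "v \<in> V" "nonnbrs E V v = {}"
  shows "int (num_cols E V x) < falling_factorial (int x) (chi E V) * (int x - 1) ^ (card V - chi E V)"
proof -
  let ?W = "V - {v}" let ?t = "int x - 1"
  define j where "j = chi E ?W"
  define m where "m = card V - chi E V - 2"
  have k: "chi E V = Suc j" using critical_chi_Diff[OF fin v(1) crit[OF v(1)]] by (simp add: j_def)
  have cW: "card V = Suc (card ?W)" using card_Suc_Diff1[OF fin v(1)] by simp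
  have x': "int (x - 1) = ?t" using k x by simp
  have jx: "j \<le> x - 1" using k x by simp
  have W: "finite ?W" "alpha2 E ?W" using fin alpha2_subset[OF al] by auto
  have "card ?W \<noteq> 0" using cW lt k by linarith
  then have "?W \<noteq> {}" by (metis card.empty)
  then obtain u where "u \<in> ?W" by blast
  then have "j > 0" using chi_pos W(1) unfolding j_def by blast
  then have t1: "?t \<ge> 1" using jx by simp
  have e: "card ?W - j - 1 = Suc m" "j < card ?W" "card V - chi E V = Suc (Suc m)"
    using cW lt k unfolding m_def by auto
  let ?f = "falling_factorial ?t j"
  have f0: "?f > 0" using falling_factorial_pos[OF jx] x' by simp
  have W_le: "int (num_cols E ?W (x - 1)) \<le> ?f * ?t * (?t - 1) ^ Suc m"
    using num_cols_le_weak[OF W, of "x - 1"] jx e(1,2) unfolding x' j_def[symmetric] by simp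
  have "num_cols E V x \<le> x * num_cols E ?W (x - 1)"
    using num_cols_le_sum_color_class[OF fin al v(1), of x] v(2) by simp
  then have "int (num_cols E V x) \<le> int x * int (num_cols E ?W (x - 1))"
    unfolding of_nat_le_iff[symmetric, where ?'a = int] of_nat_mult .
  also have "\<dots> \<le> int x * (?f * ?t * (?t - 1) ^ Suc m)"
    using W_le by (rule mult_left_mono) simp
  also have "\<dots> = (int x * ?f * ?t) * (?t - 1) ^ Suc m" by simp
  also have "\<dots> < (int x * ?f * ?t) * ?t ^ Suc m"
    using f0 t1 by (intro mult_strict_left_mono power_strict_mono) auto
  also have "\<dots> = falling_factorial (int x) (chi E V) * ?t ^ (card V - chi E V)"
    unfolding k falling_factorial_Suc e(3)[unfolded k] by simp
  finally show ?thesis .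
qed

text \<open>The sharp bound is assumed for \<open>V - {v}\<close>. The at most \<nu> sets
  \<open>V - {v, w}\<close> may be disconnected and get the weak bound;
  \<open>power_add_less_power\<close> adds up the two contributions.\<close>

lemma critical_num_cols_less_of_Diff:
  assumes fin: "finite V" and al: "alpha2 E V" and x: "chi E V \<le> x"
    and crit: "\<And>u. u \<in> V \<Longrightarrow> chi E (V - {u}) < chi E V" and lt: "chi E V + 3 \<le> card V"
    and v: "v \<in> V"
    and W_le: "int (num_cols E (V - {v}) (x - 1)) \<le>
      falling_factorial (int x - 1) (chi E (V - {v})) * (int x - 2) ^ (card V - chi E V)"
  shows "int (num_cols E V x) < falling_factorial (int x) (chi E V) * (int x - 1) ^ (card V - chi E V)"
proof -
  let ?W = "V - {v}" let ?t = "int x - 1" let ?s = "int x - 2"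
  define j where "j = chi E ?W"
  define m where "m = card V - chi E V - 3"
  have k: "chi E V = Suc j" using critical_chi_Diff[OF fin v crit[OF v]] by (simp add: j_def)
  have cW: "card V = Suc (card ?W)" using card_Suc_Diff1[OF fin v] by simp
  have x': "int (x - 1) = ?t" using k x by simp
  have jx: "j \<le> x - 1" using k x by simp
  have "card ?W \<noteq> 0" using cW lt k by linarith
  then have "?W \<noteq> {}" by (metis card.empty)
  then obtain u where "u \<in> ?W" by blast
  then have "j > 0" using chi_pos[of ?W] fin unfolding j_def by blast
  then have s0: "?s \<ge> 0" using jx by simp
  have nu: "card V - chi E V = m + 3" using lt unfolding m_def by simp
  let ?f = "falling_factorial ?t j"
  have f0: "?f > 0" using falling_factorial_pos[OF jx] x' by simp
  have pair_le: "int (num_cols E (V - {v, w}) (x - 1)) \<le> ?f * ?t * ?s ^ (m + 1)"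
    if w: "w \<in> nonnbrs E V v" for w
  proof -
    note c = critical_chi_Diff_nonnbr[OF fin v crit[OF v] w]
    have "chi E (V - {v, w}) = j" "j < card (V - {v, w})" "card (V - {v, w}) - j - 1 = m + 1"
      using c k lt unfolding m_def by auto
    then show ?thesis
      using num_cols_le_weak[of "V - {v, w}" "x - 1"] fin jx alpha2_subset[OF al, of "V - {v, w}"]
      unfolding x' by simp
  qed
  have "int (num_cols E V x) \<le> int x * int (num_cols E ?W (x - 1) +
      (\<Sum>w\<in>nonnbrs E V v. num_cols E (V - {v, w}) (x - 1)))"
    using num_cols_le_sum_color_class[OF fin al v, of x]
    unfolding of_nat_le_iff[symmetric, where ?'a = int] of_nat_mult .
  also have "\<dots> \<le> int x * (?f * ?s ^ (m + 3) + of_nat (card (nonnbrs E V v)) * (?f * ?t * ?s ^ (m + 1)))"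
    unfolding of_nat_add of_nat_sum
    using W_le pair_le by (intro mult_left_mono add_mono sum_bounded_above) (auto simp: j_def nu)
  also have "\<dots> \<le> int x * (?f * ?s ^ (m + 3) + (int m + 3) * (?f * ?t * ?s ^ (m + 1)))"
  proof (intro mult_left_mono add_left_mono mult_right_mono)
    show "of_nat (card (nonnbrs E V v)) \<le> int m + 3"
      using card_nonnbrs_le_of_critical[OF fin al v crit[OF v]] nu by simp
  qed (use f0 s0 in auto)
  also have "\<dots> = (int x * ?f) * (?s ^ (m + 3) + (int m + 3) * (?s + 1) * ?s ^ (m + 1))"
    by (simp add: algebra_simps)
  also have "\<dots> < (int x * ?f) * (?s + 1) ^ (m + 3)"
    using f0 s0 by (intro mult_strict_left_mono power_add_less_power) auto
  also have "\<dots> = falling_factorial (int x) (chi E V) * ?t ^ (card V - chi E V)"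
    unfolding nu unfolding k falling_factorial_Suc by simp
  finally show ?thesis .
qed

text \<open>A noncritical vertex has a neighbour and passes strictness on. In the critical case some
  \<open>V - {v}\<close> is connected and satisfies the sharp bound, either through a clique of its
  chromatic number or by induction.\<close>

lemma num_cols_less_of_no_clique:
  assumes "finite V" "alpha2 E V" "chi E V \<le> x" "4 \<le> chi E V"
    and "\<And>Q. Q \<subseteq> V \<Longrightarrow> clique E Q \<Longrightarrow> card Q < chi E V"
  shows "int (num_cols E V x) < falling_factorial (int x) (chi E V) * (int x - 1) ^ (card V - chi E V)"
  using assms
proof (induction "card V" arbitrary: V x rule: less_induct)
  case less
  note fin = less.prems(1) and al = less.prems(2) and no = less.prems(5)
  let ?k = "chi E V"
  have ltV: "?k < card V" 
    using no[of V] chi_eq_card_iff[OF fin] chi_le_card[OF fin] by fastforce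
  show ?case
  proof (cases "\<exists>v\<in>V. chi E (V - {v}) = chi E V")
    case True
    then obtain v where v: "v \<in> V" "chi E (V - {v}) = ?k" by blast
    let ?W = "V - {v}"
    have W: "finite ?W" "alpha2 E ?W" "insert v ?W = V" "v \<notin> ?W" "card V = Suc (card ?W)"
      using fin al v card_Suc_Diff1[OF fin v(1)] by (auto intro: alpha2_subset)
    \<comment> \<open>Were \<open>v\<close> isolated, \<open>?W\<close> would be a clique with at
      least \<open>?k\<close> vertices.\<close>
    have "card ?W \<ge> ?k" using chi_le_card[OF W(1)] v(2) by simp
    then have "\<not> clique E ?W" using no[of ?W] by force
    then obtain u where u: "u \<in> ?W" "E v u"
      using isolated_imp_clique[OF al v(1)] irrefl by blast
    have "int (num_cols E ?W x) < falling_factorial (int x) ?k * (int x - 1) ^ (card ?W - ?k)"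
      using less.hyps[of ?W x] W(1,2,5) v(2) less.prems(3,4) no by auto
    then have "int (num_cols E ?W x) * (int x - 1) <
        falling_factorial (int x) ?k * (int x - 1) ^ (card ?W - ?k) * (int x - 1)"
      using less.prems(3,4) by (intro mult_strict_right_mono) auto
    also have "\<dots> = falling_factorial (int x) ?k * (int x - 1) ^ Suc (card ?W - ?k)" by simp
    also have "Suc (card ?W - ?k) = card V - ?k" using W(5) \<open>card ?W \<ge> ?k\<close> by linarith
    finally show ?thesis
      using num_cols_insert_le_nbr[OF W(1,4) u, of x, THEN int_le_mult_diff] W(3) less.prems(3,4) by simp
  next
    case False
    then have crit: "chi E (V - {u}) < chi E V" if "u \<in> V" for u
      using that chi_mono[of V "V - {u}"] fin by fastforce
    have nu2: "?k + 2 \<le> card V" using critical_deficiency_ge_2[OF fin al crit ltV] .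
    show ?thesis
    proof (cases "\<exists>v\<in>V. nonnbrs E V v = {}")
      case True
      then show ?thesis
        using critical_num_cols_less_of_isolated[OF fin al less.prems(3) crit nu2] by blast
    next
      case noiso: False
      \<comment> \<open>With deficiency 2 every vertex would have exactly two nonneighbours, and a
        complement matching of size 3 would save a third color.\<close>
      have nu3: "?k + 3 \<le> card V"
      proof (rule ccontr)
        assume "\<not> ?k + 3 \<le> card V"
        then have nu: "card V = ?k + 2" using nu2 by simp
        have "card (nonnbrs E V u) = 2" if u: "u \<in> V" for u
        proof -
          have "card (nonnbrs E V u) \<noteq> 0" using noiso u finite_nonnbrs[OF fin] by simp
          moreover have "card (nonnbrs E V u) \<noteq> 1" using card_nonnbrs_neq_1_of_critical[OF fin crit u] .
          moreover have "card (nonnbrs E V u) \<le> 2"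
            using card_nonnbrs_le_of_critical[OF fin al u crit[OF u]] nu by simp
          ultimately show ?thesis by linarith
        qed
        then show False using chi_le_of_two_nonnbrs[OF fin al] nu less.prems(4) by simp
      qed
      obtain v where v: "v \<in> V" using ltV by fastforce
      let ?W = "V - {v}"
      have k: "?k = Suc (chi E ?W)" using critical_chi_Diff[OF fin v crit[OF v]] .
      have cW: "card V = Suc (card ?W)" using card_Suc_Diff1[OF fin v] by simp
      have W: "finite ?W" "alpha2 E ?W" using fin alpha2_subset[OF al] by auto
      have jx: "chi E ?W \<le> x - 1" "int (x - 1) = int x - 1" "int (x - 1) - 1 = int x - 2"
        "card ?W - chi E ?W = card V - ?k" using k less.prems(3) cW by auto
      \<comment> \<open>A disconnected \<open>?W\<close> would yield a clique of size
        \<open>?k\<close> in \<open>V\<close>.\<close>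
      have conn: "conn E ?W"
        using clique_of_disconnected_Diff[OF fin al crit v] no by (metis leD)
      have "int (num_cols E ?W (x - 1)) \<le>
        falling_factorial (int (x - 1)) (chi E ?W) * (int (x - 1) - 1) ^ (card ?W - chi E ?W)"
      proof (cases "\<exists>Q\<subseteq>?W. clique E Q \<and> chi E ?W \<le> card Q")
        case True
        then obtain Q where Q: "Q \<subseteq> ?W" "clique E Q" "card Q = chi E ?W"
          using clique_le_chi[OF W(1)] by (metis le_antisym)
        then have "Q \<noteq> {}" using k less.prems(4) by auto
        then show ?thesis using num_cols_le_of_clique[OF W(1) conn Q(1) _ Q(2)] Q(3) jx(1) by simp
      next
        case False
        then have no': "card Q < chi E ?W" if "Q \<subseteq> ?W" "clique E Q" for Q
          using that by (meson not_le)
        \<comment> \<open>The induction starts at 4. For chromatic number 3 the set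
          \<open>?W\<close> has at least six vertices and thus a triangle, which is a clique of full
          size.\<close>
        have "chi E ?W \<noteq> 3"
        proof
          assume c3: "chi E ?W = 3"
          have "card ?W \<ge> 6" using nu3 less.prems(4) cW by simp
          then obtain Q where "Q \<subseteq> ?W" "clique E Q" "card Q = 3" using exists_triangle[OF W] by blast
          then show False using no'[of Q] c3 by simp
        qed
        then have "4 \<le> chi E ?W" using k less.prems(4) by linarith
        then show ?thesis using less.hyps[OF _ W jx(1) _ no'] cW by simp
      qed
      then have "int (num_cols E ?W (x - 1)) \<le>
          falling_factorial (int x - 1) (chi E ?W) * (int x - 2) ^ (card V - ?k)"
        using jx(2,4) by simp
      then show ?thesis
        by (intro critical_num_cols_less_of_Diff[OF fin al less.prems(3) _ nu3 v] crit)
    qed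
  qed
qed


section \<open>The equality case\<close>

text \<open>Vertices outside a set \<open>S\<close> multiply the count by at most
  \<open>x - 1\<close> each, so equality for \<open>V\<close> forces equality along every build-up
  from \<open>Q\<close>. Then no coloring may show a newly added vertex two colors.\<close>

lemma clique_extremal_structure:
  assumes fin: "finite V" and con: "conn E V" and al: "alpha2 E V"
    and Q: "Q \<subseteq> V" "clique E Q" and four: "4 \<le> card Q" and x: "card Q \<le> x"
    and eq: "int (num_cols E V x) = falling_factorial (int x) (card Q) * (int x - 1) ^ (card V - card Q)"
  shows "V = Q \<or>
    (\<exists>a p. a \<notin> Q \<and> V = insert a Q \<and> {u \<in> Q. E a u} = {p}) \<or>
    (\<exists>a b p. a \<notin> Q \<and> b \<notin> insert a Q \<and> V = insert b (insert a Q) \<and>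
       {u \<in> Q. E a u} = {p} \<and> {u \<in> insert a Q. E b u} = {a})"
proof (cases "V = Q")
  case VQ: False
  let ?k = "card Q" and ?t = "int x - 1"
  \<comment> \<open>The upper bound is carried as an invariant of sets built up from
    \<open>Q\<close> by adding adjacent vertices; other sets between \<open>Q\<close> and
    \<open>V\<close> may be disconnected.\<close>
  define up where "up S \<longleftrightarrow> int (num_cols E S x) \<le> falling_factorial (int x) ?k * ?t ^ (card S - ?k)" for S
  have ff0: "falling_factorial (int x) ?k > 0" using falling_factorial_pos[OF x] .
  have t: "?t > 1" using four x by simp
  have finS: "finite S" if "S \<subseteq> V" for S using fin that by (rule finite_subset[rotated])
  have Q0: "Q \<noteq> {}" using four by auto
  have kS: "?k \<le> card S" if "Q \<subseteq> S" "S \<subseteq> V" for S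
    using that finS[OF that(2)] by (intro card_mono)
  \<comment> \<open>The matching lower bound holds for every \<open>S\<close> between
    \<open>Q\<close> and \<open>V\<close>: a smaller count could not be made up for on the way to
    \<open>V\<close>.\<close>
  have tight: "falling_factorial (int x) ?k * ?t ^ (card S - ?k) \<le> int (num_cols E S x)"
    if S: "Q \<subseteq> S" "S \<subseteq> V" for S
  proof (rule ccontr)
    assume "\<not> ?thesis"
    then have "int (num_cols E S x) * ?t ^ (card V - card S) <
        falling_factorial (int x) ?k * ?t ^ (card S - ?k) * ?t ^ (card V - card S)"
      using t by (intro mult_strict_right_mono) auto
    also have "\<dots> = falling_factorial (int x) ?k * ?t ^ ((card S - ?k) + (card V - card S))"
      by (simp add: power_add)
    also have "(card S - ?k) + (card V - card S) = card V - ?k"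
      using kS[OF S] card_mono[OF fin S(2)] by simp
    finally have "int (num_cols E S x) * ?t ^ (card V - card S) < int (num_cols E V x)" unfolding eq .
    moreover have "int (num_cols E V x) \<le> int (num_cols E S x) * ?t ^ (card V - card S)"
      using num_cols_le_extend[OF fin con S(2), of x] S Q0 t by auto
    ultimately show False by simp
  qed
  have cardS: "card (insert v S) - ?k = Suc (card S - ?k)" if "Q \<subseteq> S" "S \<subseteq> V" "v \<notin> S" for v S
    using kS[OF that(1,2)] that(3) finS[OF that(2)] by simp
  have not_less: "\<not> int (num_cols E (insert v S) x) < int (num_cols E S x) * ?t"
    if S: "Q \<subseteq> S" "S \<subseteq> V" "up S" "v \<in> V" "v \<notin> S" for v S
  proof
    assume "int (num_cols E (insert v S) x) < int (num_cols E S x) * ?t"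
    also have "\<dots> \<le> falling_factorial (int x) ?k * ?t ^ (card S - ?k) * ?t"
      using S(3) t unfolding up_def by (intro mult_right_mono) auto
    also have "\<dots> = falling_factorial (int x) ?k * ?t ^ (card (insert v S) - ?k)"
      unfolding cardS[OF S(1,2,5)] by simp
    finally show False using tight[of "insert v S"] S by auto
  qed
  have up_insert: "up (insert v S)" if S: "Q \<subseteq> S" "S \<subseteq> V" "up S" "v \<notin> S" "u \<in> S" "E v u" for u v S
  proof -
    have "int (num_cols E (insert v S) x) \<le> int (num_cols E S x) * ?t"
      using num_cols_insert_le_nbr[OF finS[OF S(2)] S(4-6), of x, THEN int_le_mult_diff] t by simp
    also have "\<dots> \<le> falling_factorial (int x) ?k * ?t ^ (card S - ?k) * ?t"
      using S(3) t unfolding up_def by (intro mult_right_mono) auto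
    also have "\<dots> = falling_factorial (int x) ?k * ?t ^ (card (insert v S) - ?k)"
      unfolding cardS[OF S(1,2,4)] by simp
    finally show ?thesis unfolding up_def .
  qed
  have no_two: False
    if S: "Q \<subseteq> S" "S \<subseteq> V" "up S" "v \<in> V" "v \<notin> S" and e: "u \<in> S" "E v u" "w \<in> S" "E v w" "E u w" for u v w S
  proof -
    have "int (num_cols E (insert v S) x) \<le> int (num_cols E S x) * (int x - 2)"
      using num_cols_insert_le_two_nbrs[OF finS[OF S(2)] S(5) e, of x, THEN int_le_mult_diff] t by simp
    moreover have "int (num_cols E S x) > 0"
      using tight[OF S(1,2)] ff0 t by (meson less_le_trans mult_pos_pos zero_less_power less_trans zero_less_one)
    then have "int (num_cols E S x) * (int x - 2) < int (num_cols E S x) * ?t"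
      by (intro mult_strict_left_mono) auto
    ultimately show False using not_less[OF S] by simp
  qed
  have upQ: "up Q" unfolding up_def using num_cols_clique[OF finS[OF Q(1)] Q(2) x] by simp
  have one: "card {u \<in> Q. E a u} \<le> 1" if a: "a \<in> V" "a \<notin> Q" for a
  proof (rule ccontr)
    assume "\<not> ?thesis"
    then obtain u w where "u \<in> Q" "E a u" "w \<in> Q" "E a w" "u \<noteq> w"
      using finS[OF Q(1)] by (auto simp: card_le_Suc0_iff_eq)
    then show False using no_two[OF order_refl Q(1) upQ a, of u w] Q(2) by (auto simp: clique_def)
  qed
  \<comment> \<open>Together \<open>a\<close> and \<open>b\<close> see at most two of the at least
    four vertices of \<open>Q\<close>, so some \<open>p\<close> in \<open>Q\<close> misses both, and
    \<open>alpha2\<close> makes them adjacent.\<close>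
  have adj: "E a b" if ab: "a \<in> V" "a \<notin> Q" "b \<in> V" "b \<notin> Q" "a \<noteq> b" for a b
  proof -
    let ?A = "{u \<in> Q. E a u}" and ?B = "{u \<in> Q. E b u}"
    have "card (?A \<union> ?B) \<le> 2" using card_Un_le[of ?A ?B] one[OF ab(1,2)] one[OF ab(3,4)] by linarith
    then have "\<not> Q \<subseteq> ?A \<union> ?B" using four finS[OF Q(1)] card_mono[of "?A \<union> ?B" Q] by auto
    then obtain p where p: "p \<in> Q" "\<not> E a p" "\<not> E b p" by blast
    then have "p \<in> V" "p \<noteq> a" "p \<noteq> b" using Q(1) ab by auto
    then show ?thesis using alpha2D[OF al ab(1,3), of p] p ab by auto
  qed
  have "\<exists>u\<in>Q. \<exists>v\<in>V - Q. E u v"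
    using con Q0 Q(1) VQ unfolding conn_def by (simp add: psubset_eq)
  then obtain a p where a: "p \<in> Q" "a \<in> V" "a \<notin> Q" "E a p" using sym by blast
  have na: "{u \<in> Q. E a u} = {p}"
    using one[OF a(2,3)] a(1,4) finS[OF Q(1)] by (auto simp: card_le_Suc0_iff_eq)
  let ?S = "insert a Q"
  have S: "Q \<subseteq> ?S" "?S \<subseteq> V" using Q a by auto
  have upS: "up ?S" using up_insert[OF order_refl Q(1) upQ a(3,1,4)] .
  show ?thesis
  proof (cases "V = ?S")
    case True
    then show ?thesis using a(3) na by blast
  next
    case False
    then obtain b where b: "b \<in> V" "b \<notin> ?S" using S by blast
    have ba: "E b a" using adj[of b a] a b by auto
    have nb: "\<not> E b q" if q: "q \<in> Q" for q
    proof
      assume bq: "E b q"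
      show False
      proof (cases "q = p")
        case True
        then show False using no_two[OF S upS b, of a p] ba bq a by auto
      next
        case qp: False
        have "\<not> Q \<subseteq> {p, q}" using four card_mono[of "{p, q}" Q] card_insert_le_m1[of 2 "{q}" p] by auto
        \<comment> \<open>Only \<open>p\<close> restricts the color of \<open>a\<close>, so
          \<open>a\<close> can copy the color of \<open>r\<close>, which differs from that of
          \<open>q\<close>. Then \<open>b\<close> sees two colors, at \<open>a\<close> and at
          \<open>q\<close>.\<close>
        then obtain r where r: "r \<in> Q" "r \<noteq> p" "r \<noteq> q" by blast
        obtain h where h: "inj_on h Q" "h ` Q \<subseteq> {1..x}"
          using card_le_inj[of Q "{1..x}"] finS[OF Q(1)] x by auto
        define g where "g = restrict (h(a := h r)) ?S"
        have hQ: "h u \<in> {1..x}" if "u \<in> Q" for u using h(2) that by blast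
        have hne: "h u \<noteq> h w" if "u \<in> Q" "w \<in> Q" "u \<noteq> w" for u w using h(1) that by (auto dest: inj_onD)
        have nap: "\<not> E a u" if "u \<in> Q" "u \<noteq> p" for u using na that by blast
        have "proper E ?S (h(a := h r))" unfolding proper_def
        proof (intro ballI impI)
          fix u w assume uw: "u \<in> ?S" "w \<in> ?S" "E u w"
          have "h r \<noteq> h p" using hne r a(1) by blast
          then have *: "h r \<noteq> h z" if "z \<in> Q" "E a z" for z using nap that by metis
          have ne: "u \<noteq> w" using uw(3) irrefl by auto
          show "(h(a := h r)) u \<noteq> (h(a := h r)) w"
          proof (cases "u = a \<or> w = a")
            case True
            then show ?thesis using ne uw *[of w] *[of u] sym[of u w] by auto
          next
            case False
            then show ?thesis using ne uw hne[of u w] by simp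
          qed
        qed
        then have "proper E ?S g" unfolding proper_def g_def by simp
        then have gc: "g \<in> cols E ?S {1..x}"
          using hQ r(1) unfolding cols_def g_def by auto
        have "g a = h r" "g q = h q" using a(3) q unfolding g_def by auto
        then have "g a \<noteq> g q" using hne[OF r(1) q] r(3) by simp
        then have "card {g a, g q} = 2" by simp
        moreover have "finite (g ` {u \<in> ?S. E b u})" using finS[OF S(2)] by simp
        moreover have "{g a, g q} \<subseteq> g ` {u \<in> ?S. E b u}" using ba bq q by auto
        ultimately have "2 \<le> card (g ` {u \<in> ?S. E b u})"
          by (metis card_mono)
        then have "num_cols E (insert b ?S) x < num_cols E ?S x * (x - 1)"
          using four x by (intro num_cols_insert_less[OF finS[OF S(2)] b(2) _ ba gc]) auto
        then have "int (num_cols E (insert b ?S) x) < int (num_cols E ?S x) * ?t"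
          using t unfolding of_nat_less_iff[symmetric, where ?'a = int] by (simp add: of_nat_diff)
        then show False using not_less[OF S upS b] by simp
      qed
    qed
    have nb': "{u \<in> ?S. E b u} = {a}" using nb ba by auto
    let ?T = "insert b ?S"
    have T: "Q \<subseteq> ?T" "?T \<subseteq> V" using S b by auto
    have upT: "up ?T" using up_insert[OF S upS b(2) _ ba] by simp
    \<comment> \<open>A third outside vertex would see the adjacent vertices \<open>a\<close> and
      \<open>b\<close>, hence two colors.\<close>
    have "V = ?T"
    proof (rule ccontr)
      assume "V \<noteq> ?T"
      then obtain c where c: "c \<in> V" "c \<notin> ?T" using T by blast
      have "E c a" "E c b" using adj[of c a] adj[of c b] a b c by auto
      then show False using no_two[OF T upT c, of b a] ba by auto
    qed
    then show ?thesis using a(3) b(2) na nb' by blast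
  qed
qed simp

end

section \<open>Graphs as pair digraphs\<close>

lemma (in pair_graph) adjacency_parcs: "adjacency (\<lambda>u v. (u, v) \<in> parcs G)"
  by unfold_locales (auto dest: arcs_symmetric no_loops')

lemma (in pair_graph) colorings_eq_cols:
  "colorings G x = cols (\<lambda>u v. (u, v) \<in> parcs G) (pverts G) {1..x}"
  unfolding colorings_def cols_def proper_def by (auto dest: wellformed')

lemma (in pair_graph) chromatic_number_eq_chi:
  "chromatic_number G = chi (\<lambda>u v. (u, v) \<in> parcs G) (pverts G)"
  unfolding chromatic_number_def chi_def colorings_eq_cols colorable_iff_cols[OF pair_finite_verts] ..

lemma (in pair_graph) alpha2_of_independence_number:
  assumes "independence_number G \<le> 2"
  shows "alpha2 (\<lambda>u v. (u, v) \<in> parcs G) (pverts G)"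
  unfolding alpha2_def
proof (intro ballI impI, rule ccontr)
  fix u v w assume m: "u \<in> pverts G" "v \<in> pverts G" "w \<in> pverts G" and ne: "u \<noteq> v" "u \<noteq> w" "v \<noteq> w"
    and no: "\<not> ((u, v) \<in> parcs G \<or> (u, w) \<in> parcs G \<or> (v, w) \<in> parcs G)"
  have "independent_set G {u, v, w}"
    using m no no_loops' arcs_symmetric unfolding independent_set_def by blast
  moreover have "finite {S. independent_set G S}"
    by (rule finite_subset[of _ "Pow (pverts G)"]) (auto simp: independent_set_def pair_finite_verts)
  ultimately have "card {u, v, w} \<le> independence_number G"
    unfolding independence_number_def by (intro Max_ge) auto
  then show False using ne assms by simp
qed

lemma (in pair_graph) conn_of_connected:
  assumes "Digraph_Component.connected (with_proj G)"
  shows "conn (\<lambda>u v. (u, v) \<in> parcs G) (pverts G)"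
  unfolding conn_def
proof (intro allI impI, rule ccontr)
  fix S assume S: "S \<noteq> {}" "S \<subset> pverts G" and no: "\<not> (\<exists>u\<in>S. \<exists>v\<in>pverts G - S. (u, v) \<in> parcs G)"
  obtain u v where uv: "u \<in> S" "v \<in> pverts G" "v \<notin> S" using S by blast
  \<comment> \<open>\<open>connected\<close> speaks of the symmetric closure; reachability is the
    same because the arcs of \<open>G\<close> are already symmetric.\<close>
  then have "u \<rightarrow>\<^sup>*\<^bsub>mk_symmetric G\<^esub> v"
    using assms S unfolding connected_def strongly_connected_def by auto
  then have "u \<rightarrow>\<^sup>*\<^bsub>with_proj G\<^esub> v" by (simp add: reachable_mk_symmetric_eq pair_sym_arcs)
  then have "v \<in> S"
  proof (induction rule: reachable_induct)
    case base
    show ?case using uv by simp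
  next
    case (step x y)
    then have "y \<in> pverts G" using wellformed'(2)[of x y] by simp
    then show ?case using step no by auto
  qed
  then show False using uv by simp
qed

section \<open>Isomorphism with a clique with a path\<close>

lemma digraph_iso_with_projI:
  assumes G: "pair_graph G" and F: "pair_graph F"
    and h: "bij_betw h (pverts G) (pverts F)"
    and arcs: "\<And>u v. u \<in> pverts G \<Longrightarrow> v \<in> pverts G \<Longrightarrow> (u, v) \<in> parcs G \<longleftrightarrow> (h u, h v) \<in> parcs F"
  shows "digraph_iso (with_proj G) (with_proj F)"
proof -
  interpret G: pair_graph G by fact
  interpret F: pair_graph F by fact
  \<comment> \<open>Arcs are pairs, so the vertex map determines the arc map, and the projections
    remain tail and head.\<close>
  let ?f = "\<lparr>iso_verts = h, iso_arcs = map_prod h h, iso_head = snd, iso_tail = fst\<rparr>"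
  have inj: "inj_on h (pverts G)" and im: "h ` pverts G = pverts F" using h by (auto simp: bij_betw_def)
  have "inj_on (map_prod h h) (parcs G)"
    by (rule inj_on_subset[OF map_prod_inj_on[OF inj inj]]) (auto dest: G.wellformed')
  then have "pre_digraph.digraph_isomorphism (with_proj G) ?f"
    using inj by (simp add: pre_digraph.digraph_isomorphism_def G.wf_digraph)
  moreover have "map_prod h h ` parcs G = parcs F"
  proof
    show "map_prod h h ` parcs G \<subseteq> parcs F"
    proof (rule image_subsetI)
      fix e assume e: "e \<in> parcs G"
      obtain u v where uv: "e = (u, v)" by (cases e)
      then show "map_prod h h e \<in> parcs F"
        using e arcs[of u v] G.wellformed'(1)[of u v] G.wellformed'(2)[of u v] by simp
    qed
    show "parcs F \<subseteq> map_prod h h ` parcs G"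
    proof
      fix e assume e: "e \<in> parcs F"
      obtain a b where ab: "e = (a, b)" by (cases e)
      then have "a \<in> pverts F" "b \<in> pverts F"
        using e F.wellformed'(1)[of a b] F.wellformed'(2)[of a b] by simp_all
      then obtain u v where uv: "u \<in> pverts G" "v \<in> pverts G" "a = h u" "b = h v" using im by blast
      then have "(u, v) \<in> parcs G" using arcs e ab by simp
      then show "e \<in> map_prod h h ` parcs G" using ab uv by force
    qed
  qed
  then have "with_proj F = app_iso ?f (with_proj G)"
    using im by (simp add: app_iso_def with_proj_def)
  ultimately show ?thesis unfolding digraph_iso_def by blast
qed

lemma digraph_iso_with_projD:
  assumes G: "pair_graph G" and "digraph_iso (with_proj G) (with_proj F)"
  obtains h where "bij_betw h (pverts G) (pverts F)"
    and "\<And>u v. u \<in> pverts G \<Longrightarrow> v \<in> pverts G \<Longrightarrow> (u, v) \<in> parcs G \<longleftrightarrow> (h u, h v) \<in> parcs F"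
proof -
  interpret G: pair_graph G by fact
  obtain f where f: "pre_digraph.digraph_isomorphism (with_proj G) f"
    and F: "with_proj F = app_iso f (with_proj G)"
    using assms(2) unfolding digraph_iso_def by blast
  let ?h = "iso_verts f"
  have FE: "pverts F = ?h ` pverts G" "parcs F = iso_arcs f ` parcs G" "fst = iso_tail f" "snd = iso_head f"
    using F by (auto simp: app_iso_def with_proj_def)
  have inj: "inj_on ?h (pverts G)" using f by (simp add: pre_digraph.digraph_isomorphism_def)
  \<comment> \<open>Tail and head of the image are the projections, so an arbitrary arc map must act
    componentwise through the vertex map.\<close>
  have e: "iso_arcs f (u, v) = (?h u, ?h v)" if "(u, v) \<in> parcs G" for u v
  proof -
    have "?h u = iso_tail f (iso_arcs f (u, v))" "?h v = iso_head f (iso_arcs f (u, v))"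
      using f that by (auto simp: pre_digraph.digraph_isomorphism_def)
    then show ?thesis unfolding FE(3,4)[symmetric] by (simp add: prod_eq_iff)
  qed
  show thesis
  proof (rule that[of ?h])
    show "bij_betw ?h (pverts G) (pverts F)" using inj FE(1) by (simp add: bij_betw_def)
    fix u v assume uv: "u \<in> pverts G" "v \<in> pverts G"
    show "(u, v) \<in> parcs G \<longleftrightarrow> (?h u, ?h v) \<in> parcs F"
    proof
      assume "(u, v) \<in> parcs G"
      then show "(?h u, ?h v) \<in> parcs F" using e FE(2) by (metis imageI)
    next
      assume "(?h u, ?h v) \<in> parcs F"
      then obtain a b where ab: "(a, b) \<in> parcs G" "(?h u, ?h v) = iso_arcs f (a, b)" using FE(2) by auto
      then have "?h u = ?h a" "?h v = ?h b" using e by auto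
      then show "(u, v) \<in> parcs G" using inj uv ab(1) G.wellformed'(1)[OF ab(1)] G.wellformed'(2)[OF ab(1)] by (metis inj_onD)
    qed
  qed
qed

text \<open>One relation for all path lengths: \<open>l\<close> enters only through the vertex set
  \<open>{..<k + l}\<close>, so inductions add one vertex at a time.\<close>

definition clique_path_adj :: "nat \<Rightarrow> nat \<Rightarrow> nat \<Rightarrow> bool" where
  "clique_path_adj k i j \<longleftrightarrow> i \<noteq> j \<and> (i < k \<and> j < k \<or> j = Suc i \<or> i = Suc j)"

lemma parcs_clique_with_path:
  "i < k + l \<Longrightarrow> j < k + l \<Longrightarrow> (i, j) \<in> parcs (clique_with_path l k) \<longleftrightarrow> clique_path_adj k i j"
  by (simp add: clique_with_path_def clique_path_adj_def)

lemma num_cols_clique_path_adj: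
  assumes "1 \<le> k" "k \<le> x"
  shows "int (num_cols (clique_path_adj k) {..<k + l} x) = falling_factorial (int x) k * (int x - 1) ^ l"
proof -
  interpret adjacency "clique_path_adj k" by unfold_locales (auto simp: clique_path_adj_def)
  show ?thesis
  proof (induction l)
    case 0
    have "clique (clique_path_adj k) {..<k}" by (auto simp: clique_def clique_path_adj_def)
    then show ?case using num_cols_clique[of "{..<k}" x] assms(2) by simp
  next
    case (Suc l)
    \<comment> \<open>The new vertex \<open>k + l\<close> sees only its predecessor, which for
      \<open>l = 0\<close> is the clique vertex \<open>k - 1\<close>.\<close>
    have "{u \<in> {..<k + l}. clique_path_adj k (k + l) u} = {k + l - 1}"
      using assms(1) by (auto simp: clique_path_adj_def)
    then have "num_cols (clique_path_adj k) (insert (k + l) {..<k + l}) x =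
        num_cols (clique_path_adj k) {..<k + l} x * (x - 1)"
      by (intro num_cols_insert_pendant) auto
    then show ?case using Suc assms by (simp add: lessThan_Suc of_nat_diff)
  qed
qed

text \<open>A partial isomorphism that numbers \<open>S\<close> by \<open>0, ..., m - 1\<close>; on
  the full vertex set with \<open>m = k + l\<close> it identifies the graph with
  \<open>clique_with_path l k\<close>.\<close>

definition clique_path_embedding :: "('a \<Rightarrow> 'a \<Rightarrow> bool) \<Rightarrow> nat \<Rightarrow> 'a set \<Rightarrow> nat \<Rightarrow> ('a \<Rightarrow> nat) \<Rightarrow> bool" where
  "clique_path_embedding E k S m h \<longleftrightarrow>
     bij_betw h S {..<m} \<and> (\<forall>u\<in>S. \<forall>v\<in>S. E u v \<longleftrightarrow> clique_path_adj k (h u) (h v))"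

context adjacency begin

text \<open>Any numbering of a clique works, so \<open>p\<close> can take the last number
  \<open>card Q - 1\<close>, where the path is attached.\<close>

lemma clique_path_embedding_clique:
  assumes "finite Q" "clique E Q" "p \<in> Q"
  obtains h where "clique_path_embedding E (card Q) Q (card Q) h" "h p = card Q - 1"
proof -
  let ?k = "card Q"
  have k: "?k \<noteq> 0" using assms(1,3) by auto
  have "card (Q - {p}) = card {..<?k - 1}" using assms(1,3) by simp
  then obtain b where b: "bij_betw b (Q - {p}) {..<?k - 1}"
    using assms(1) finite_same_card_bij by blast
  have "bij_betw (b(p := ?k - 1)) (Q - {p}) {..<?k - 1}"
    using b by (subst bij_betw_cong[where g = b]) auto
  then have "bij_betw (b(p := ?k - 1)) (insert p (Q - {p})) (insert (?k - 1) {..<?k - 1})"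
    using notIn_Un_bij_betw[of p "Q - {p}" "b(p := ?k - 1)" "{..<?k - 1}"] by simp
  then have h: "bij_betw (b(p := ?k - 1)) Q {..<?k}"
    using assms(3) k by (metis Suc_diff_1 insert_Diff lessThan_Suc neq0_conv)
  have "E u v \<longleftrightarrow> clique_path_adj ?k ((b(p := ?k - 1)) u) ((b(p := ?k - 1)) v)" if "u \<in> Q" "v \<in> Q" for u v
  proof -
    have "E u v \<longleftrightarrow> u \<noteq> v" using assms(2) that irrefl by (auto simp: clique_def)
    moreover have "(b(p := ?k - 1)) u < ?k" "(b(p := ?k - 1)) v < ?k"
      using bij_betwE[OF h] that by (auto simp del: fun_upd_apply)
    ultimately show ?thesis using h that unfolding clique_path_adj_def bij_betw_def
      by (metis inj_on_contraD)
  qed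
  then show thesis using that h unfolding clique_path_embedding_def by (metis fun_upd_same)
qed

text \<open>As \<open>k \<le> m\<close>, the number \<open>m\<close> lies outside the clique and its
  only smaller neighbour is \<open>m - 1\<close>, the number of \<open>p\<close>.\<close>

lemma clique_path_embedding_insert:
  assumes h: "clique_path_embedding E k S m h" and m: "1 \<le> k" "k \<le> m" and p: "h p = m - 1"
    and v: "v \<notin> S" "{u \<in> S. E v u} = {p}"
  shows "clique_path_embedding E k (insert v S) (Suc m) (h(v := m))"
  unfolding clique_path_embedding_def
proof
  have b: "bij_betw h S {..<m}" using h by (simp add: clique_path_embedding_def)
  have "bij_betw (h(v := m)) S {..<m}"
    using b v(1) by (subst bij_betw_cong[where g = h]) auto
  then have "bij_betw (h(v := m)) (insert v S) (insert m {..<m})"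
    using v(1) notIn_Un_bij_betw[of v S "h(v := m)" "{..<m}"] by simp
  then show "bij_betw (h(v := m)) (insert v S) {..<Suc m}" by (simp only: lessThan_Suc)
  have pS: "p \<in> S" using v(2) by blast
  have key: "E v u \<longleftrightarrow> clique_path_adj k m (h u)" if "u \<in> S" for u
  proof -
    have "E v u \<longleftrightarrow> u = p" using v(2) that by blast
    also have "\<dots> \<longleftrightarrow> h u = m - 1" using b that pS p unfolding bij_betw_def by (metis inj_onD)
    also have "\<dots> \<longleftrightarrow> clique_path_adj k m (h u)"
      using bij_betwE[OF b] that m by (auto simp: clique_path_adj_def)
    finally show ?thesis .
  qed
  have symA: "clique_path_adj k i j \<longleftrightarrow> clique_path_adj k j i" for i j by (auto simp: clique_path_adj_def)
  show "\<forall>u\<in>insert v S. \<forall>w\<in>insert v S. E u w \<longleftrightarrow> clique_path_adj k ((h(v := m)) u) ((h(v := m)) w)"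
  proof (intro ballI)
    fix u w assume uw: "u \<in> insert v S" "w \<in> insert v S"
    show "E u w \<longleftrightarrow> clique_path_adj k ((h(v := m)) u) ((h(v := m)) w)"
    proof (cases "u = v"; cases "w = v")
      assume "u = v" "w = v"
      then show ?thesis using irrefl by (simp add: clique_path_adj_def)
    next
      assume "u = v" "w \<noteq> v"
      then show ?thesis using key[of w] uw by simp
    next
      assume "u \<noteq> v" "w = v"
      then show ?thesis using key[of u] uw sym[of u v] sym[of v u] symA[of m "h u"] by auto
    next
      assume "u \<noteq> v" "w \<noteq> v"
      then show ?thesis using h uw by (simp add: clique_path_embedding_def)
    qed
  qed
qed

end

lemma digraph_iso_clique_with_path:
  assumes "pair_graph G" "clique_path_embedding (\<lambda>u v. (u, v) \<in> parcs G) k (pverts G) (k + l) h"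
  shows "digraph_iso (with_proj G) (with_proj (clique_with_path l k))"
proof (rule digraph_iso_with_projI[OF assms(1) pair_graph_clique_with_path])
  have h: "bij_betw h (pverts G) {..<k + l}"
    using assms(2) by (simp add: clique_path_embedding_def)
  then show "bij_betw h (pverts G) (pverts (clique_with_path l k))"
    by (simp add: clique_with_path_def)
  fix u v assume uv: "u \<in> pverts G" "v \<in> pverts G"
  then have "h u < k + l" "h v < k + l" using bij_betwE[OF h] by auto
  then show "(u, v) \<in> parcs G \<longleftrightarrow> (h u, h v) \<in> parcs (clique_with_path l k)"
    using assms(2) uv by (simp add: parcs_clique_with_path clique_path_embedding_def)
qed

text \<open>The count is carried along the isomorphism; the vertex count identifies the exponent
  \<open>l\<close> with \<open>n - k\<close> in the theorem.\<close>

lemma num_cols_of_digraph_iso: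
  assumes G: "pair_graph G" and "digraph_iso (with_proj G) (with_proj (clique_with_path l k))"
    and "1 \<le> k" "k \<le> x"
  shows "int (num_cols (\<lambda>u v. (u, v) \<in> parcs G) (pverts G) x) = falling_factorial (int x) k * (int x - 1) ^ l"
    and "card (pverts G) = k + l"
proof -
  obtain h where h: "bij_betw h (pverts G) {..<k + l}"
    and arcs: "\<And>u v. u \<in> pverts G \<Longrightarrow> v \<in> pverts G \<Longrightarrow>
      (u, v) \<in> parcs G \<longleftrightarrow> (h u, h v) \<in> parcs (clique_with_path l k)"
    using digraph_iso_with_projD[OF assms(1,2)] by (auto simp: clique_with_path_def)
  have "(u, v) \<in> parcs G \<longleftrightarrow> clique_path_adj k (h u) (h v)" if "u \<in> pverts G" "v \<in> pverts G" for u v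
    using arcs[OF that] bij_betwE[OF h] that by (simp add: parcs_clique_with_path)
  then have "num_cols (\<lambda>u v. (u, v) \<in> parcs G) (pverts G) x = num_cols (clique_path_adj k) {..<k + l} x"
    by (intro card_cols_bij[OF h _ bij_betw_id]) auto
  then show "int (num_cols (\<lambda>u v. (u, v) \<in> parcs G) (pverts G) x) = falling_factorial (int x) k * (int x - 1) ^ l"
    using num_cols_clique_path_adj[OF assms(3,4)] by simp
  show "card (pverts G) = k + l" using bij_betw_same_card[OF h] by simp
qed

theorem theorem2p5:
  fixes G :: "'a pair_pre_digraph" and k n :: nat
  assumes "k \<ge> 4"
    and "pair_graph G"
    and "Digraph_Component.connected (with_proj G)"
    and "card (pverts G) = n"
    and "chromatic_number G = k"
    and "independence_number G \<le> 2"
  shows "\<forall>x::nat. x \<ge> k \<longrightarrow>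
      poly (chromatic_polynomial G) (int x)
        \<le> falling_factorial (int x) k * (int x - 1) ^ (n - k)
    \<and> (poly (chromatic_polynomial G) (int x)
          = falling_factorial (int x) k * (int x - 1) ^ (n - k)
        \<longleftrightarrow> digraph_iso (with_proj G) (with_proj (clique_with_path 1 k))
          \<or> digraph_iso (with_proj G) (with_proj (clique_with_path 2 k))
          \<or> k = n)"
proof (intro allI impI)
  fix x :: nat assume x: "k \<le> x"
  interpret pair_graph G by fact
  define E where "E = (\<lambda>u v. (u, v) \<in> parcs G)"
  interpret E: adjacency E unfolding E_def by (rule adjacency_parcs)
  let ?V = "pverts G"
  have fin: "finite ?V" by (rule pair_finite_verts)
  have k: "chi E ?V = k" using assms(5) chromatic_number_eq_chi unfolding E_def by simp
  have al: "alpha2 E ?V" using alpha2_of_independence_number[OF assms(6)] unfolding E_def .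
  have con: "conn E ?V" using conn_of_connected[OF assms(3)] unfolding E_def .
  have P: "poly (chromatic_polynomial G) (int x) = int (num_cols E ?V x)"
    using poly_chromatic_polynomial[OF assms(2), of x] unfolding colorings_eq_cols E_def .
  let ?b = "falling_factorial (int x) k * (int x - 1) ^ (n - k)"
  let ?iso = "\<lambda>l. digraph_iso (with_proj G) (with_proj (clique_with_path l k))"
  have iso_eq: "int (num_cols E ?V x) = ?b" if "?iso l" for l
    using num_cols_of_digraph_iso[OF assms(2) that] assms(1,4) x unfolding E_def by simp
  \<comment> \<open>With \<open>k = n\<close> the whole graph is a clique and the power of
    \<open>x - 1\<close> is trivial.\<close>
  have complete_eq: "int (num_cols E ?V x) = ?b" if "k = n"
    using E.num_cols_clique[OF fin, of x] E.chi_eq_card_iff[OF fin] assms(4) k that x by simp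
  have "int (num_cols E ?V x) \<le> ?b \<and> (int (num_cols E ?V x) = ?b \<longrightarrow> ?iso 1 \<or> ?iso 2 \<or> k = n)"
  proof (cases "\<exists>Q\<subseteq>?V. clique E Q \<and> k \<le> card Q")
    case False
    \<comment> \<open>Strictness excludes equality here; all extremal graphs contain a clique of
      size \<open>k\<close>.\<close>
    then have "int (num_cols E ?V x) < ?b"
      using E.num_cols_less_of_no_clique[OF fin al] x assms(1,4) unfolding k by (auto simp: not_le)
    then show ?thesis by simp
  next
    case True
    then obtain Q where Q: "Q \<subseteq> ?V" "clique E Q" "card Q = k"
      using E.clique_le_chi[OF fin] k by (metis le_antisym)
    have finQ: "finite Q" and Q0: "Q \<noteq> {}" using Q(1,3) fin assms(1) by (auto intro: finite_subset)
    have le: "int (num_cols E ?V x) \<le> ?b"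
      using E.num_cols_le_of_clique[OF fin con Q(1) Q0 Q(2), of x] Q(3) x assms(4) by simp
    have "?iso 1 \<or> ?iso 2 \<or> k = n" if "int (num_cols E ?V x) = ?b"
    proof -
      have four: "4 \<le> card Q" and xQ: "card Q \<le> x"
        and eq: "int (num_cols E ?V x) = falling_factorial (int x) (card Q) * (int x - 1) ^ (card ?V - card Q)"
        using that Q(3) assms(1,4) x by simp_all
      have emb: "?iso l" if "clique_path_embedding E k ?V (k + l) h" for l h
        using digraph_iso_clique_with_path[OF assms(2)] that unfolding E_def .
      consider "?V = Q"
        | a p where "a \<notin> Q" "?V = insert a Q" "{u \<in> Q. E a u} = {p}"
        | a b p where "a \<notin> Q" "b \<notin> insert a Q" "?V = insert b (insert a Q)"
            "{u \<in> Q. E a u} = {p}" "{u \<in> insert a Q. E b u} = {a}"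
        using E.clique_extremal_structure[OF fin con al Q(1,2) four xQ eq] by (elim disjE exE conjE)
      then show ?thesis
      proof cases
        case 1
        then show ?thesis using Q(3) assms(4) by simp
      next
        case 2
        then have "p \<in> Q" by blast
        then obtain h where "clique_path_embedding E k Q k h" "h p = k - 1"
          using E.clique_path_embedding_clique[OF finQ Q(2)] Q(3) by metis
        then have "clique_path_embedding E k ?V (Suc k) (h(a := k))"
          using E.clique_path_embedding_insert[of k Q k h p a] 2 assms(1) by simp
        then show ?thesis using emb[of 1] by simp
      next
        case 3
        then have "p \<in> Q" by blast
        then obtain h where "clique_path_embedding E k Q k h" "h p = k - 1"
          using E.clique_path_embedding_clique[OF finQ Q(2)] Q(3) by metis
        then have "clique_path_embedding E k (insert a Q) (Suc k) (h(a := k))"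
          using E.clique_path_embedding_insert[of k Q k h p a] 3 assms(1) by simp
        \<comment> \<open>Now \<open>a\<close> carries the last number, so the path continues from
          it to \<open>b\<close>.\<close>
        then have "clique_path_embedding E k ?V (Suc (Suc k)) (h(a := k, b := Suc k))"
          using E.clique_path_embedding_insert[of k "insert a Q" "Suc k" "h(a := k)" a b] 3 assms(1) by simp
        then show ?thesis using emb[of 2] by simp
      qed
    qed
    then show ?thesis using le by blast
  qed
  then show "poly (chromatic_polynomial G) (int x) \<le> ?b \<and>
      (poly (chromatic_polynomial G) (int x) = ?b \<longleftrightarrow> ?iso 1 \<or> ?iso 2 \<or> k = n)"
    unfolding P using iso_eq complete_eq by blast
qed

end
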